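(* For every integer $n\ge 3$, $\tilde H_{\nu_{2n}}(M(D_n)) \neq 0$.
   Context: For $A\subseteq[m]\times[n]$ (a set of positions on an $m\times n$ chessboard), $M(A)$ is the simplicial complex of nontaking rooks on $A$: its vertex set is $A$ and its faces are the subsets $\{(i_1,j_1),\dots,(i_k,j_k)\}\subseteq A$ with $i_s\neq i_t$ and $j_s\neq j_t$ for all $s\neq t$. $D_n=[n]\times[n]\setminus\{(1,1),(2,2),\dots,(n,n)\}$. $\nu_{N}=\lfloor\frac{N+1}{3}\rfloor-1$, so $\nu_{2n}=\lfloor\frac{2n+1}{3}\rfloor-1$. $\tilde H_*$ denotes reduced simplicial homology with integer coefficients. *)

theory Defs
  imports "HOL-Algebra.Free_Abelian_Groups" "HOL-Library.Product_Lexorder"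
begin

section \<open>Reduced simplicial homology with integer coefficients\<close>

text \<open>
  An abstract simplicial complex is given by its set of faces. The empty set is a face (of dimension
  -1) of every nonempty complex, so the chain complex below is automatically the augmented one and
  its homology is reduced homology. Dimensions are integers for this reason.
\<close>

definition simplicial_complex :: "'a set set \<Rightarrow> bool" where
  "simplicial_complex K \<longleftrightarrow>
     (\<forall>\<sigma>\<in>K. finite \<sigma>) \<and> (\<forall>\<sigma>\<in>K. \<forall>\<tau>. \<tau> \<subseteq> \<sigma> \<longrightarrow> \<tau> \<in> K)"

definition faces :: "int \<Rightarrow> 'a set set \<Rightarrow> 'a set set" where
  "faces k K = {\<sigma> \<in> K. finite \<sigma> \<and> int (card \<sigma>) = k + 1}"

definition simplicial_chain_group :: "int \<Rightarrow> 'a set set \<Rightarrow> ('a set \<Rightarrow>\<^sub>0 int) monoid" where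
  "simplicial_chain_group k K = free_Abelian_group (faces k K)"

text \<open>
  Every face is oriented by the linear order on the vertices: if \<open>\<sigma> = {v\<^sub>0 < \<dots> < v\<^sub>k}\<close>, then the
  index of the vertex \<open>v\<close> is the number of vertices of \<open>\<sigma>\<close> below it. On a vertex, the boundary map
  is the augmentation onto the chains on the empty face. The homology groups do not depend, up to
  isomorphism, on the choice of the order.
\<close>

definition face_boundary :: "'a::linorder set \<Rightarrow> 'a set \<Rightarrow>\<^sub>0 int" where
  "face_boundary \<sigma> =
     (\<Sum>v\<in>\<sigma>. frag_cmul ((-1) ^ card {w\<in>\<sigma>. w < v}) (frag_of (\<sigma> - {v})))"

definition simplicial_boundary :: "('a::linorder set \<Rightarrow>\<^sub>0 int) \<Rightarrow> 'a set \<Rightarrow>\<^sub>0 int" where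
  "simplicial_boundary = frag_extend face_boundary"

definition cycles :: "int \<Rightarrow> 'a::linorder set set \<Rightarrow> ('a set \<Rightarrow>\<^sub>0 int) set" where
  "cycles k K =
     kernel (simplicial_chain_group k K) (simplicial_chain_group (k - 1) K) simplicial_boundary"

definition boundaries :: "int \<Rightarrow> 'a::linorder set set \<Rightarrow> ('a set \<Rightarrow>\<^sub>0 int) set" where
  "boundaries k K = simplicial_boundary ` carrier (simplicial_chain_group (k + 1) K)"

definition reduced_homology_group ::
    "int \<Rightarrow> 'a::linorder set set \<Rightarrow> ('a set \<Rightarrow>\<^sub>0 int) set monoid" where
  "reduced_homology_group k K =
     (simplicial_chain_group k K)\<lparr>carrier := cycles k K\<rparr> Mod boundaries k K"


section \<open>Chessboard complexes\<close>

definition rook_complex :: "(nat \<times> nat) set \<Rightarrow> (nat \<times> nat) set set" where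
  "rook_complex A = {\<sigma>. \<sigma> \<subseteq> A \<and> finite \<sigma> \<and>
     (\<forall>p\<in>\<sigma>. \<forall>q\<in>\<sigma>. p \<noteq> q \<longrightarrow> fst p \<noteq> fst q \<and> snd p \<noteq> snd q)}"

definition off_diagonal_board :: "nat \<Rightarrow> (nat \<times> nat) set" where
  "off_diagonal_board n = {1..n} \<times> {1..n} - {(i, i) |i. i \<in> {1..n}}"

definition nu :: "nat \<Rightarrow> int" where
  "nu N = \<lfloor>(of_nat N + 1) / (3 :: rat)\<rfloor> - 1"


section \<open>Well-definedness\<close>

lemma nu_eq_div: "nu N = (int N + 1) div 3 - 1"
proof -
  have "(of_nat N + 1) / (3::rat) = of_int (int N + 1) / of_int 3" by simp
  then show ?thesis unfolding nu_def by (metis floor_divide_of_int_eq)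
qed

lemma simplicial_complex_rook_complex: "simplicial_complex (rook_complex A)"
  unfolding simplicial_complex_def
proof (intro conjI ballI allI impI)
  fix \<sigma> \<tau> assume \<sigma>: "\<sigma> \<in> rook_complex A" and \<tau>: "\<tau> \<subseteq> \<sigma>"
  from \<sigma> have "\<sigma> \<subseteq> A" "finite \<sigma>" by (simp_all add: rook_complex_def)
  with \<tau> have "\<tau> \<subseteq> A" "finite \<tau>" by (auto intro: finite_subset)
  moreover have "fst p \<noteq> fst q \<and> snd p \<noteq> snd q" if "p \<in> \<tau>" "q \<in> \<tau>" "p \<noteq> q" for p q
    using \<sigma> that subsetD [OF \<tau>] unfolding rook_complex_def by blast
  ultimately show "\<tau> \<in> rook_complex A" by (simp add: rook_complex_def)
qed (simp add: rook_complex_def)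

lemma simplicial_boundary_diff:
  "simplicial_boundary (a - b) = simplicial_boundary a - simplicial_boundary b"
  by (simp add: simplicial_boundary_def frag_extend_diff)

lemma simplicial_boundary_add:
  "simplicial_boundary (a + b) = simplicial_boundary a + simplicial_boundary b"
  by (simp add: simplicial_boundary_def frag_extend_add)

lemma simplicial_boundary_zero [simp]: "simplicial_boundary 0 = 0"
  by (simp add: simplicial_boundary_def)

lemma simplicial_boundary_of [simp]: "simplicial_boundary (frag_of \<sigma>) = face_boundary \<sigma>"
  by (simp add: simplicial_boundary_def)

lemma simplicial_boundary_cmul:
  "simplicial_boundary (frag_cmul c a) = frag_cmul c (simplicial_boundary a)"
  by (simp add: simplicial_boundary_def frag_extend_cmul)

lemma simplicial_boundary_sum:
  "simplicial_boundary (sum g I) = (\<Sum>i\<in>I. simplicial_boundary (g i))"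
  by (induction I rule: infinite_finite_induct) (simp_all add: simplicial_boundary_add)

lemma keys_face_boundary:
  assumes "simplicial_complex K" "\<sigma> \<in> faces k K"
  shows "Poly_Mapping.keys (face_boundary \<sigma>) \<subseteq> faces (k - 1) K"
proof -
  have "Poly_Mapping.keys (frag_cmul c (frag_of (\<sigma> - {v}))) \<subseteq> faces (k - 1) K"
    if "v \<in> \<sigma>" for c v
  proof -
    have "finite \<sigma>" using assms(2) by (simp add: faces_def)
    then have "card \<sigma> = Suc (card (\<sigma> - {v}))" using that by (rule card.remove)
    then have "\<sigma> - {v} \<in> faces (k - 1) K"
      using assms by (auto simp: faces_def simplicial_complex_def)
    then show ?thesis by (cases "c = 0") auto
  qed
  then show ?thesis
    unfolding face_boundary_def
    by (rule subset_trans [OF keys_sum UN_least])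
qed

lemma simplicial_boundary_hom:
  assumes "simplicial_complex K"
  shows "simplicial_boundary \<in> hom (simplicial_chain_group k K) (simplicial_chain_group (k - 1) K)"
proof (rule homI)
  fix x assume "x \<in> carrier (simplicial_chain_group k K)"
  then have keys: "Poly_Mapping.keys x \<subseteq> faces k K"
    by (simp add: simplicial_chain_group_def)
  have "Poly_Mapping.keys (simplicial_boundary x) \<subseteq> faces (k - 1) K"
    unfolding simplicial_boundary_def
  proof (rule subset_trans [OF keys_frag_extend UN_least])
    fix \<sigma> assume "\<sigma> \<in> Poly_Mapping.keys x"
    with keys have "\<sigma> \<in> faces k K" by (rule subsetD)
    with assms show "Poly_Mapping.keys (face_boundary \<sigma>) \<subseteq> faces (k - 1) K"
      by (rule keys_face_boundary)
  qed
  then show "simplicial_boundary x \<in> carrier (simplicial_chain_group (k - 1) K)"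
    by (simp add: simplicial_chain_group_def)
qed (simp add: simplicial_chain_group_def simplicial_boundary_add)

lemma sign_swap:
  fixes v w :: "'a::linorder"
  assumes "finite \<sigma>" "v \<in> \<sigma>" "w \<in> \<sigma>" "v < w"
  shows "(-1::int) ^ card {u\<in>\<sigma>. u < v} * (-1) ^ card {u\<in>\<sigma> - {v}. u < w} =
       - ((-1) ^ card {u\<in>\<sigma>. u < w} * (-1) ^ card {u\<in>\<sigma> - {w}. u < v})"
proof -
  have 1: "{u\<in>\<sigma> - {w}. u < v} = {u\<in>\<sigma>. u < v}"
    using less_not_sym [OF \<open>v < w\<close>] by blast
  have "{u\<in>\<sigma>. u < w} = insert v {u\<in>\<sigma> - {v}. u < w}"
    using \<open>v \<in> \<sigma>\<close> \<open>v < w\<close> by blast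
  moreover have "finite {u\<in>\<sigma> - {v}. u < w}" using \<open>finite \<sigma>\<close> by simp
  moreover have "v \<notin> {u\<in>\<sigma> - {v}. u < w}" by blast
  ultimately have 2: "card {u\<in>\<sigma>. u < w} = Suc (card {u\<in>\<sigma> - {v}. u < w})"
    by (simp only: card_insert_disjoint not_False_eq_True)
  show ?thesis unfolding 1 2 by simp
qed

lemma simplicial_boundary_face_boundary:
  fixes \<sigma> :: "'a::linorder set"
  assumes "finite \<sigma>"
  shows "simplicial_boundary (face_boundary \<sigma>) = 0"
proof -
  define e where "e v w = (if v = w then 0 else
    frag_cmul ((-1) ^ card {u\<in>\<sigma>. u < v} * (-1) ^ card {u\<in>\<sigma> - {v}. u < w})
      (frag_of (\<sigma> - {v} - {w})))" for v w
  have "simplicial_boundary (face_boundary \<sigma>) = (\<Sum>v\<in>\<sigma>. \<Sum>w\<in>\<sigma> - {v}. e v w)"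
    unfolding face_boundary_def [of \<sigma>] simplicial_boundary_sum
      simplicial_boundary_cmul simplicial_boundary_of face_boundary_def frag_cmul_sum frag_cmul_cmul
  proof (intro sum.cong refl)
    fix v w assume "w \<in> \<sigma> - {v}"
    then have "v \<noteq> w" by auto
    then show "frag_cmul ((-1) ^ card {u\<in>\<sigma>. u < v} * (-1) ^ card {u\<in>\<sigma> - {v}. u < w})
        (frag_of (\<sigma> - {v} - {w})) = e v w"
      unfolding e_def by (simp only: if_False)
  qed
  also have "\<dots> = (\<Sum>v\<in>\<sigma>. \<Sum>w\<in>\<sigma>. e v w)"
    using assms by (intro sum.cong refl sum.mono_neutral_left) (auto simp: e_def)
  finally have S: "simplicial_boundary (face_boundary \<sigma>) = (\<Sum>v\<in>\<sigma>. \<Sum>w\<in>\<sigma>. e v w)" .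
  have anti: "e v w = - e w v" if "v \<in> \<sigma>" "w \<in> \<sigma>" for v w
  proof -
    have *: "e v w = - e w v" if "v < w" "v \<in> \<sigma>" "w \<in> \<sigma>" for v w
    proof -
      have 1: "\<sigma> - {w} - {v} = \<sigma> - {v} - {w}" by auto
      have "v \<noteq> w" "w \<noteq> v" using that(1) by auto
      then show ?thesis
        unfolding e_def 1 sign_swap [OF assms that(2,3,1)] by simp
    qed
    show ?thesis
    proof (cases v w rule: linorder_cases)
      case less
      then show ?thesis using that by (rule *)
    next
      case equal
      then show ?thesis by (simp add: e_def)
    next
      case greater
      have "e w v = - e v w" by (rule *) (fact greater that)+
      then show ?thesis by simp
    qed
  qed
  let ?S = "\<Sum>v\<in>\<sigma>. \<Sum>w\<in>\<sigma>. e v w"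
  have "?S = (\<Sum>v\<in>\<sigma>. \<Sum>w\<in>\<sigma>. - e w v)"
    by (rule sum.cong [OF refl], rule sum.cong [OF refl], rule anti)
  also have "\<dots> = - (\<Sum>v\<in>\<sigma>. \<Sum>w\<in>\<sigma>. e w v)" by (simp add: sum_negf)
  also have "(\<Sum>v\<in>\<sigma>. \<Sum>w\<in>\<sigma>. e w v) = ?S" by (rule sum.swap)
  finally have neg: "?S = - ?S" .
  have "?S = 0"
  proof (rule poly_mapping_eqI)
    fix k
    have "poly_mapping.lookup ?S k = - poly_mapping.lookup ?S k"
      using arg_cong [OF neg, of "\<lambda>c. poly_mapping.lookup c k"]
      unfolding lookup_uminus .
    then have "poly_mapping.lookup ?S k = 0" by linarith
    then show "poly_mapping.lookup ?S k = poly_mapping.lookup 0 k" by (simp only: lookup_zero)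
  qed
  with S show ?thesis by (rule trans)
qed

lemma simplicial_boundary_boundary:
  assumes "x \<in> carrier (simplicial_chain_group k K)"
  shows "simplicial_boundary (simplicial_boundary x) = 0"
proof -
  have "Poly_Mapping.keys x \<subseteq> faces k K" using assms by (simp add: simplicial_chain_group_def)
  then show ?thesis
  proof (rule free_Abelian_group_induct)
    fix \<sigma> assume "\<sigma> \<in> faces k K"
    then have "finite \<sigma>" by (simp add: faces_def)
    then show "simplicial_boundary (simplicial_boundary (frag_of \<sigma>)) = 0"
      by (simp add: simplicial_boundary_face_boundary)
  qed (simp_all add: simplicial_boundary_diff)
qed

lemma comm_group_reduced_homology_group:
  assumes "simplicial_complex K"
  shows "comm_group (reduced_homology_group k K)"
proof -
  let ?C = "\<lambda>k. simplicial_chain_group k K"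
  have grp: "group (?C k)" for k by (simp add: simplicial_chain_group_def)
  have hom: "group_hom (?C k) (?C (k - 1)) simplicial_boundary" for k
    using grp simplicial_boundary_hom [OF assms] by (simp add: group_hom_def group_hom_axioms_def)
  have Z: "subgroup (cycles k K) (?C k)"
    unfolding cycles_def by (rule group_hom.subgroup_kernel [OF hom])
  have B: "subgroup (boundaries k K) (?C k)"
    using group_hom.img_is_subgroup [OF hom, of "k + 1"] by (simp add: boundaries_def)
  have BZ: "boundaries k K \<subseteq> cycles k K"
  proof
    fix b assume b: "b \<in> boundaries k K"
    then have "b \<in> carrier (?C k)" using subgroup.subset [OF B] by (rule set_rev_mp)
    moreover have "simplicial_boundary b = 0"
      using b simplicial_boundary_boundary by (auto simp: boundaries_def)
    ultimately show "b \<in> cycles k K"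
      by (simp add: cycles_def kernel_def simplicial_chain_group_def)
  qed
  have commZ: "comm_group (?C k\<lparr>carrier := cycles k K\<rparr>)"
    by (rule group.group_comm_groupI [OF subgroup.subgroup_is_group [OF Z grp]])
       (simp add: simplicial_chain_group_def)
  have "subgroup (boundaries k K) (?C k\<lparr>carrier := cycles k K\<rparr>)"
    by (rule group.subgroup_incl [OF grp B Z BZ])
  then show ?thesis
    unfolding reduced_homology_group_def
    by (rule comm_group.abelian_FactGroup [OF commZ])
qed

end

theory Submission
  imports Defs "HOL-Library.Numeral_Type"
begin

text \<open>
  Regard row \<open>i\<close> of the board as the vertex \<open>i\<close>, column \<open>j\<close> as the vertex \<open>n + j\<close>, and a cell as an
  edge. Placements of nontaking rooks become matchings, so the complex of the off-diagonal board is
  a subcomplex of the matching complex of the complete graph on \<open>2 n\<close> vertices. A homology class is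
  nonzero as soon as a cocycle of the larger complex takes a nonzero value on a cycle that
  represents it. The lowest homology of large matching complexes is 3-torsion, so the cocycle takes
  values in the integers modulo 3. The degree of a cochain is here the number \<open>p\<close> of edges of the
  matchings on which it is evaluated.

  The cocycles rest on one vanishing statement: every \<open>p\<close>-cocycle on the matchings of at least \<open>3 p
  + 2\<close> vertices is a coboundary (\<open>acyclic_degree\<close>). Two consequences make classes comparable. On at
  least \<open>3 p + 1\<close> vertices a class is determined by its restriction to the complement of one vertex
  (\<open>coboundary_on_insert\<close>), and on at least \<open>3 p\<close> vertices a class is determined by what remains of
  it after matching one of two chosen vertices (\<open>coboundary_on_pair\<close>).

  On exactly \<open>3 p + 1\<close> vertices there is a class \<open>\<phi>\<^sub>V\<close> that is natural in the vertex set \<open>V\<close> up to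
  the sign of an orientation of \<open>V\<close> (\<open>bottom_family\<close>). It is built by induction on \<open>p\<close>. Choose two
  vertices \<open>b\<close>, \<open>c\<close> of a set of \<open>3 p + 4\<close> vertices and let the value on a matching containing the
  edge \<open>b x\<close> be given, up to sign, by the class of the \<open>3 p + 1\<close> vertices other than \<open>b\<close>, \<open>c\<close>, \<open>x\<close>,
  and with the opposite sign for \<open>c x\<close>. Such a cocycle exists because the classes on the smaller
  sets agree where they overlap. The point is that the result does not depend on \<open>b\<close> and \<open>c\<close>
  (\<open>pair_extension_change_vertex\<close>): comparing two choices produces three equal contributions of the
  same class, and these cancel modulo 3.

  The cycles are joins of differences \<open>ab - ac\<close> of two edges with a common end, taken over \<open>p\<close>
  disjoint triples \<open>(a, b, c)\<close>. By construction, evaluating \<open>\<phi>\<^sub>V\<close> on such a join multiplies the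
  value for \<open>p - 1\<close> triples by \<open>2\<close> or \<open>- 2\<close>, which is a unit modulo 3, so the value is never zero
  (\<open>bottom_family_exists\<close>). On the board, a triple consists of two rows and a column or of a row and
  two columns. For \<open>n = 3 k\<close> and \<open>n = 3 k + 2\<close> the board has room for enough triples avoiding the
  diagonal. For \<open>n = 3 k + 1\<close> there are \<open>3 p + 2\<close> vertices with \<open>p = 2 k\<close> and the degree is \<open>p + 1\<close>,
  too much for a join of triples. There the cocycle is \<open>\<phi>\<close> preceded by one fixed edge, and the cycle
  is the join of a triangulated 2-sphere in the \<open>4 \<times> 4\<close> board with a join of triples; the link of
  the fixed edge in it is again a join of triples (\<open>sphere_facets\<close>).
\<close>

section \<open>Cochains, coboundary and contraction\<close>

definition order_sign :: "'a::linorder \<Rightarrow> 'a set \<Rightarrow> 'r::comm_ring_1" where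
  "order_sign x A = (-1) ^ card {a\<in>A. a < x}"

text \<open>
  The factor by which \<open>order_sign x\<close> changes when \<open>a\<close> joins the set. All sign computations reduce to
  its antisymmetry: exchanging two neighbours of an orientation costs one factor \<open>-1\<close>.
\<close>
definition swap_sign :: "'a::linorder \<Rightarrow> 'a \<Rightarrow> 'r::comm_ring_1" where
  "swap_sign x a = (if a < x then -1 else 1)"

lemma swap_sign_antisym: "x \<noteq> a \<Longrightarrow> swap_sign a x = - (swap_sign x a :: 'r::comm_ring_1)"
  by (auto simp: swap_sign_def)

lemma swap_sign_square [simp]: "swap_sign x a * swap_sign x a = (1 :: 'r::comm_ring_1)"
  by (simp add: swap_sign_def)

lemma order_sign_square [simp]: "order_sign x A * order_sign x A = (1 :: 'r::comm_ring_1)"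
  by (simp add: order_sign_def flip: power_add mult_2)

lemma order_sign_empty [simp]: "order_sign x {} = 1"
  by (simp add: order_sign_def)

lemma order_sign_cancel [simp]: "order_sign x A * (order_sign x A * z) = (z :: 'r::comm_ring_1)"
  by (simp flip: mult.assoc)

lemma swap_sign_cancel [simp]: "swap_sign x a * (swap_sign x a * z) = (z :: 'r::comm_ring_1)"
  by (simp flip: mult.assoc)

lemma order_sign_insert:
  assumes "finite A" "a \<notin> A"
  shows "order_sign x (insert a A) = swap_sign x a * (order_sign x A :: 'r::comm_ring_1)"
proof (cases "a < x")
  case True
  then have "{w\<in>insert a A. w < x} = insert a {w\<in>A. w < x}" by auto
  then show ?thesis using assms True by (simp add: order_sign_def swap_sign_def)
next
  case False
  then have "{w\<in>insert a A. w < x} = {w\<in>A. w < x}" by auto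
  then show ?thesis using False by (simp add: order_sign_def swap_sign_def)
qed

lemma order_sign_insert_self:
  assumes "finite A" "x \<notin> A"
  shows "order_sign x (insert x A) = (order_sign x A :: 'r::comm_ring_1)"
  using order_sign_insert[OF assms, of x] by (simp add: swap_sign_def)

text \<open>
  Cochains are arbitrary functions on sets. Restricting them to the faces of a complex is left to
  the statements, so that the same function can be viewed on several complexes.
\<close>
definition coboundary :: "('a::linorder set \<Rightarrow> 'r::comm_ring_1) \<Rightarrow> 'a set \<Rightarrow> 'r" where
  "coboundary f \<sigma> = (\<Sum>v\<in>\<sigma>. order_sign v \<sigma> * f (\<sigma> - {v}))"

text \<open>
  The sign makes this the contraction of an alternating form: \<open>\<sigma>\<close> is extended by \<open>e\<close> in front and
  the result is sorted. Evaluating on sets that contain \<open>e\<close> amounts to evaluating contractions on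
  smaller sets.
\<close>
definition contraction :: "'a::linorder \<Rightarrow> ('a set \<Rightarrow> 'r::comm_ring_1) \<Rightarrow> 'a set \<Rightarrow> 'r" where
  "contraction e f \<sigma> = order_sign e \<sigma> * f (insert e \<sigma>)"

lemma coboundary_empty [simp]: "coboundary f {} = 0"
  by (simp add: coboundary_def)

lemma coboundary_zero [simp]: "coboundary (\<lambda>_. 0) = (\<lambda>_. 0)"
  by (simp add: coboundary_def fun_eq_iff)

lemma coboundary_add: "coboundary (\<lambda>\<sigma>. f \<sigma> + g \<sigma>) \<sigma> = coboundary f \<sigma> + coboundary g \<sigma>"
  by (simp add: coboundary_def sum.distrib algebra_simps)

lemma coboundary_diff: "coboundary (\<lambda>\<sigma>. f \<sigma> - g \<sigma>) \<sigma> = coboundary f \<sigma> - coboundary g \<sigma>"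
  by (simp add: coboundary_def sum_subtractf algebra_simps)

lemma coboundary_scale: "coboundary (\<lambda>\<sigma>. c * f \<sigma>) \<sigma> = c * coboundary f \<sigma>"
  by (simp add: coboundary_def sum_distrib_left algebra_simps)

lemma coboundary_uminus: "coboundary (\<lambda>\<sigma>. - f \<sigma>) \<sigma> = - coboundary f \<sigma>"
  by (simp add: coboundary_def sum_negf)

lemma contraction_diff: "contraction e (\<lambda>\<sigma>. f \<sigma> - g \<sigma>) = (\<lambda>\<sigma>. contraction e f \<sigma> - contraction e g \<sigma>)"
  by (simp add: contraction_def algebra_simps fun_eq_iff)

lemma contraction_scale: "contraction e (\<lambda>\<sigma>. c * f \<sigma>) = (\<lambda>\<sigma>. c * contraction e f \<sigma>)"
  by (simp add: contraction_def algebra_simps fun_eq_iff)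

text \<open>
  Cartan's formula in this setting: removing \<open>e\<close> itself from \<open>insert e \<sigma>\<close> gives \<open>f \<sigma>\<close>, and removing
  another element commutes with contraction up to the sign of passing it across \<open>e\<close>.
\<close>
lemma contraction_coboundary:
  assumes "finite \<sigma>" "e \<notin> \<sigma>"
  shows "contraction e (coboundary f) \<sigma> = f \<sigma> - coboundary (contraction e f) \<sigma>"
proof -
  have "order_sign e \<sigma> * (order_sign v (insert e \<sigma>) * f (insert e \<sigma> - {v})) =
      - (order_sign v \<sigma> * contraction e f (\<sigma> - {v}))" if v: "v \<in> \<sigma>" for v
  proof -
    have ne: "v \<noteq> e" using v assms by auto
    have 1: "order_sign e \<sigma> = swap_sign e v * (order_sign e (\<sigma> - {v}) :: 'b)"
      using order_sign_insert[of "\<sigma> - {v}" v e] assms v by (simp add: insert_absorb)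
    have 2: "insert e \<sigma> - {v} = insert e (\<sigma> - {v})" using ne by auto
    show ?thesis
      unfolding contraction_def 2 1 order_sign_insert[OF assms] swap_sign_antisym[OF ne[symmetric]]
      by (simp add: algebra_simps)
  qed
  then show ?thesis
    using assms
    by (simp add: contraction_def[of e "coboundary f"] coboundary_def order_sign_insert_self
        distrib_left sum_distrib_left sum_negf insert_Diff_if)
qed

section \<open>Matchings of a complete graph\<close>

definition edge :: "'v::linorder \<Rightarrow> 'v \<Rightarrow> 'v \<times> 'v" where
  "edge a b = (min a b, max a b)"

definition matchings :: "'v::linorder set \<Rightarrow> ('v \<times> 'v) set set" where
  "matchings V = {\<sigma>. finite \<sigma> \<and> (\<forall>e\<in>\<sigma>. fst e < snd e \<and> fst e \<in> V \<and> snd e \<in> V) \<and>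
     (\<forall>d\<in>\<sigma>. \<forall>e\<in>\<sigma>. d \<noteq> e \<longrightarrow> {fst d, snd d} \<inter> {fst e, snd e} = {})}"

lemma edge_commute: "edge a b = edge b a"
  by (simp add: edge_def min.commute max.commute)

lemma finite_matching: "\<sigma> \<in> matchings V \<Longrightarrow> finite \<sigma>"
  by (simp add: matchings_def)

lemma empty_matching [simp]: "{} \<in> matchings V"
  by (simp add: matchings_def)

lemma matchings_mono: "\<sigma> \<in> matchings V \<Longrightarrow> V \<subseteq> W \<Longrightarrow> \<sigma> \<in> matchings W"
  unfolding matchings_def by blast

lemma matchings_subset: "\<sigma> \<in> matchings V \<Longrightarrow> \<tau> \<subseteq> \<sigma> \<Longrightarrow> \<tau> \<in> matchings V"
  unfolding matchings_def by (blast intro: finite_subset)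

lemma edge_notin_matching: "\<sigma> \<in> matchings V \<Longrightarrow> b \<notin> V \<or> x \<notin> V \<Longrightarrow> edge b x \<notin> \<sigma>"
  unfolding matchings_def edge_def by (auto simp: min_def max_def split: if_splits)

lemma insert_edge_matching:
  assumes "\<tau> \<in> matchings W" "b \<notin> W" "x \<notin> W" "b \<noteq> x"
  shows "insert (edge b x) \<tau> \<in> matchings (insert b (insert x W))"
proof -
  obtain u w where uw: "edge b x = (u, w)" "u < w" "{u, w} = {b, x}"
    by (rule that[of "min b x" "max b x"]) (use assms(4) in \<open>auto simp: edge_def min_def max_def\<close>)
  then have in_bx: "u \<in> {b, x}" "w \<in> {b, x}" by auto
  have apart: "{fst e, snd e} \<inter> {u, w} = {}" if "e \<in> \<tau>" for e
    using assms that unfolding matchings_def uw(3) by blast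
  have "finite \<tau>" and \<tau>: "\<And>e. e \<in> \<tau> \<Longrightarrow> fst e < snd e \<and> fst e \<in> W \<and> snd e \<in> W"
    "\<And>d e. d \<in> \<tau> \<Longrightarrow> e \<in> \<tau> \<Longrightarrow> d \<noteq> e \<Longrightarrow> {fst d, snd d} \<inter> {fst e, snd e} = {}"
    using assms(1) by (simp_all add: matchings_def)
  show ?thesis
    unfolding matchings_def mem_Collect_eq uw(1)
  proof (intro conjI ballI impI)
    show "finite (insert (u, w) \<tau>)" using \<open>finite \<tau>\<close> by simp
    fix e assume e: "e \<in> insert (u, w) \<tau>"
    show "fst e < snd e" "fst e \<in> insert b (insert x W)" "snd e \<in> insert b (insert x W)"
      using e \<tau>(1)[of e] uw(2) in_bx by auto
    fix d assume "d \<in> insert (u, w) \<tau>" "e \<noteq> d"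
    then show "{fst e, snd e} \<inter> {fst d, snd d} = {}"
      using e \<tau>(2)[of e d] apart[of e] apart[of d] by (cases "e = (u, w)"; cases "d = (u, w)") auto
  qed
qed

lemma matchings_avoid:
  assumes \<sigma>: "\<sigma> \<in> matchings V" and v: "\<And>e. e \<in> \<sigma> \<Longrightarrow> fst e \<noteq> v \<and> snd e \<noteq> v"
  shows "\<sigma> \<in> matchings (V - {v})"
proof -
  have "fst e < snd e \<and> fst e \<in> V - {v} \<and> snd e \<in> V - {v}" if "e \<in> \<sigma>" for e
    using \<sigma> v[OF that] that unfolding matchings_def by blast
  then show ?thesis using \<sigma> unfolding matchings_def mem_Collect_eq by meson
qed

text \<open>
  The recursion behind all that follows: a vertex \<open>b\<close> is either unmatched or matched to exactly one
  \<open>x\<close>, and then the rest is a matching of the remaining vertices.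
\<close>
lemma matching_cases:
  assumes "\<sigma> \<in> matchings (insert b W)" "b \<notin> W"
  obtains "\<sigma> \<in> matchings W"
  | x \<tau> where "x \<in> W" "\<tau> \<in> matchings (W - {x})" "edge b x \<notin> \<tau>" "\<sigma> = insert (edge b x) \<tau>"
proof (cases "\<exists>e\<in>\<sigma>. b = fst e \<or> b = snd e")
  case False
  then have "\<sigma> \<in> matchings W" using assms unfolding matchings_def by auto
  then show thesis by (rule that(1))
next
  case True
  then obtain e where e: "e \<in> \<sigma>" "b = fst e \<or> b = snd e" by blast
  have lt: "fst e < snd e" "fst e \<in> insert b W" "snd e \<in> insert b W"
    using assms(1) e(1) unfolding matchings_def by auto
  define x where "x = (if b = fst e then snd e else fst e)"
  have x: "x \<in> W" "edge b x = e" "{fst e, snd e} = {b, x}"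
  proof -
    obtain u w where uw: "e = (u, w)" by (cases e)
    show "x \<in> W" "edge b x = e" "{fst e, snd e} = {b, x}"
      using lt e(2) unfolding uw x_def edge_def
      by (auto simp: uw min_def max_def insert_commute split: if_splits)
  qed
  have "\<forall>d\<in>\<sigma> - {e}. {fst d, snd d} \<inter> {b, x} = {}"
    using assms(1) e(1) unfolding matchings_def x(3)[symmetric] by blast
  then have "fst d \<in> W - {x} \<and> snd d \<in> W - {x}" if "d \<in> \<sigma> - {e}" for d
    using assms(1) that unfolding matchings_def by blast
  then have "\<sigma> - {e} \<in> matchings (W - {x})"
    using assms(1) unfolding matchings_def mem_Collect_eq by (meson Diff_iff finite_Diff)
  then show thesis using that(2)[of x "\<sigma> - {e}"] x e(1) by auto
qed

lemma insert_edge_link: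
  assumes "\<tau> \<in> matchings (W - {x})" "b \<notin> W" "x \<in> W"
  shows "insert (edge b x) \<tau> \<in> matchings (insert b W)" "edge b x \<notin> \<tau>"
    "card (insert (edge b x) \<tau>) = Suc (card \<tau>)"
proof -
  show "insert (edge b x) \<tau> \<in> matchings (insert b W)"
    using insert_edge_matching[OF assms(1), of b x] assms by (auto simp: insert_absorb)
  show "edge b x \<notin> \<tau>" by (rule edge_notin_matching[OF assms(1)]) auto
  then show "card (insert (edge b x) \<tau>) = Suc (card \<tau>)"
    using finite_matching[OF assms(1)] by simp
qed

text \<open>
  Cochains may therefore be compared separately on the matchings that avoid \<open>b\<close> and, through
  contractions, on those that use it.
\<close>
lemma matching_induct_edge:
  assumes "b \<notin> W"
    and "\<And>\<sigma>. \<sigma> \<in> matchings W \<Longrightarrow> card \<sigma> = p \<Longrightarrow> f \<sigma> = g \<sigma>"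
    and "\<And>x \<tau>. x \<in> W \<Longrightarrow> \<tau> \<in> matchings (W - {x}) \<Longrightarrow> Suc (card \<tau>) = p \<Longrightarrow>
      contraction (edge b x) f \<tau> = contraction (edge b x) g \<tau>"
    and "\<sigma> \<in> matchings (insert b W)" "card \<sigma> = p"
  shows "f \<sigma> = g \<sigma>"
  using assms(4,1)
proof (cases rule: matching_cases)
  case 1
  then show ?thesis using assms by blast
next
  case (2 x \<tau>)
  let ?s = "order_sign (edge b x) \<tau>"
  have "Suc (card \<tau>) = p"
    using 2 assms(5) finite_matching[OF 2(2)] by simp
  then have "?s * (?s * f \<sigma>) = ?s * (?s * g \<sigma>)"
    using assms(3)[OF 2(1,2)] 2(4) by (simp add: contraction_def)
  then show ?thesis by simp
qed

text \<open>
  Conversely, a cochain may be prescribed freely on the matchings that avoid \<open>b\<close> and through its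
  contractions along the edges at \<open>b\<close>, because these cases exclude each other.
\<close>
lemma glue_cochains:
  fixes h :: "('v::linorder \<times> 'v) set \<Rightarrow> 'r::comm_ring_1"
  assumes "b \<notin> W"
  obtains H where "\<And>\<sigma>. \<sigma> \<in> matchings W \<Longrightarrow> H \<sigma> = h \<sigma>"
    and "\<And>x \<tau>. x \<in> W \<Longrightarrow> \<tau> \<in> matchings (W - {x}) \<Longrightarrow> contraction (edge b x) H \<tau> = k x \<tau>"
proof -
  define partner where "partner \<sigma> = (THE x. x \<in> W \<and> edge b x \<in> \<sigma>)" for \<sigma>
  define H where "H \<sigma> = (if \<exists>x\<in>W. edge b x \<in> \<sigma>
    then let e = edge b (partner \<sigma>) in order_sign e (\<sigma> - {e}) * k (partner \<sigma>) (\<sigma> - {e})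
    else h \<sigma>)" for \<sigma>
  have "H \<sigma> = h \<sigma>" if "\<sigma> \<in> matchings W" for \<sigma>
    using edge_notin_matching[OF that, of b] assms by (auto simp: H_def)
  moreover have "contraction (edge b x) H \<tau> = k x \<tau>"
    if x: "x \<in> W" and \<tau>: "\<tau> \<in> matchings (W - {x})" for x \<tau>
  proof -
    have "y = x" if "y \<in> W" "edge b y \<in> insert (edge b x) \<tau>" for y
      using that assms x edge_notin_matching[OF \<tau>, of b y]
      by (auto simp: edge_def min_def max_def split: if_splits)
    then have "partner (insert (edge b x) \<tau>) = x"
      unfolding partner_def using x by (intro the_equality) auto
    then show ?thesis
      using x insert_edge_link(2)[OF \<tau> assms x] by (auto simp: H_def contraction_def)
  qed
  ultimately show thesis by (rule that)
qed

lemma coboundary_cong: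
  assumes "\<sigma> \<in> matchings W" "\<And>\<tau>. \<tau> \<in> matchings W \<Longrightarrow> Suc (card \<tau>) = card \<sigma> \<Longrightarrow> f \<tau> = g \<tau>"
  shows "coboundary f \<sigma> = coboundary g \<sigma>"
  unfolding coboundary_def
proof (rule sum.cong)
  fix v assume v: "v \<in> \<sigma>"
  have "f (\<sigma> - {v}) = g (\<sigma> - {v})"
    using card_Suc_Diff1[OF finite_matching[OF assms(1)] v]
    by (intro assms(2) matchings_subset[OF assms(1)]) blast+
  then show "order_sign v \<sigma> * f (\<sigma> - {v}) = order_sign v \<sigma> * g (\<sigma> - {v})" by simp
qed simp

section \<open>Cohomology of matching complexes in low degrees\<close>

text \<open>
  The degree belongs to the predicate and not to \<open>f\<close>, of which only the values on matchings with \<open>p\<close>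
  edges enter. Matchings with \<open>p\<close> edges are faces of dimension \<open>p - 1\<close>; with this indexing the
  lowest degree, that of the empty matching, is \<open>0\<close>.
\<close>
definition cocycle_on :: "nat \<Rightarrow> 'v::linorder set \<Rightarrow> (('v \<times> 'v) set \<Rightarrow> 'r::comm_ring_1) \<Rightarrow> bool" where
  "cocycle_on p V f \<longleftrightarrow> (\<forall>\<sigma>\<in>matchings V. card \<sigma> = Suc p \<longrightarrow> coboundary f \<sigma> = 0)"

definition coboundary_on :: "nat \<Rightarrow> 'v::linorder set \<Rightarrow> (('v \<times> 'v) set \<Rightarrow> 'r::comm_ring_1) \<Rightarrow> bool" where
  "coboundary_on p V f \<longleftrightarrow> (\<exists>h. \<forall>\<sigma>\<in>matchings V. card \<sigma> = p \<longrightarrow> f \<sigma> = coboundary h \<sigma>)"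

lemma cocycle_on_mono: "cocycle_on p V f \<Longrightarrow> W \<subseteq> V \<Longrightarrow> cocycle_on p W f"
  unfolding cocycle_on_def using matchings_mono by blast

lemma coboundary_on_mono: "coboundary_on p V f \<Longrightarrow> W \<subseteq> V \<Longrightarrow> coboundary_on p W f"
  unfolding coboundary_on_def using matchings_mono by blast

lemma coboundary_on_cong:
  assumes "coboundary_on p V g" "\<And>\<sigma>. \<sigma> \<in> matchings V \<Longrightarrow> card \<sigma> = p \<Longrightarrow> f \<sigma> = g \<sigma>"
  shows "coboundary_on p V f"
  using assms unfolding coboundary_on_def by metis

lemma cocycle_on_diff:
  "cocycle_on p V f \<Longrightarrow> cocycle_on p V g \<Longrightarrow> cocycle_on p V (\<lambda>\<sigma>. f \<sigma> - g \<sigma>)"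
  by (simp add: cocycle_on_def coboundary_diff)

lemma cocycle_on_scale: "cocycle_on p V f \<Longrightarrow> cocycle_on p V (\<lambda>\<sigma>. c * f \<sigma>)"
  by (simp add: cocycle_on_def coboundary_scale)

lemma coboundary_on_scale: "coboundary_on p V f \<Longrightarrow> coboundary_on p V (\<lambda>\<sigma>. c * f \<sigma>)"
  unfolding coboundary_on_def
  by (elim exE, rename_tac h, rule_tac x = "\<lambda>\<sigma>. c * h \<sigma>" in exI) (simp add: coboundary_scale)

lemma coboundary_on_add:
  "coboundary_on p V f \<Longrightarrow> coboundary_on p V g \<Longrightarrow> coboundary_on p V (\<lambda>\<sigma>. f \<sigma> + g \<sigma>)"
  unfolding coboundary_on_def
  by (elim exE, rename_tac h k, rule_tac x = "\<lambda>\<sigma>. h \<sigma> + k \<sigma>" in exI) (simp add: coboundary_add)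

lemma coboundary_on_zero: "(\<And>\<sigma>. \<sigma> \<in> matchings V \<Longrightarrow> card \<sigma> = p \<Longrightarrow> f \<sigma> = 0) \<Longrightarrow> coboundary_on p V f"
  unfolding coboundary_on_def by (rule exI[of _ "\<lambda>_. 0"]) simp

lemma coboundary_on_0: "coboundary_on 0 V f \<longleftrightarrow> f {} = 0"
proof
  assume "coboundary_on 0 V f"
  then obtain h where "\<forall>\<sigma>\<in>matchings V. card \<sigma> = 0 \<longrightarrow> f \<sigma> = coboundary h \<sigma>"
    unfolding coboundary_on_def ..
  from bspec[OF this empty_matching] show "f {} = 0" by simp
next
  assume f: "f {} = 0"
  show "coboundary_on 0 V f"
  proof (rule coboundary_on_zero)
    fix \<sigma> assume "\<sigma> \<in> matchings V" "card \<sigma> = 0"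
    then have "\<sigma> = {}" using finite_matching[of \<sigma> V] by simp
    then show "f \<sigma> = 0" using f by simp
  qed
qed

text \<open>
  A primitive \<open>h\<close> of \<open>f\<close> away from \<open>b\<close> extends to the matchings at \<open>b\<close> if the class of \<open>f - \<delta> h\<close>,
  which lives on the links of the edges \<open>b x\<close>, vanishes there. By Cartan's formula that class is
  represented by the contraction of \<open>f\<close> minus \<open>h\<close>. Keeping \<open>h\<close> fixed on \<open>W\<close> matters when the
  extension is repeated with a second vertex.
\<close>
lemma extend_primitive:
  fixes f h :: "('v::linorder \<times> 'v) set \<Rightarrow> 'r::comm_ring_1"
  assumes b: "b \<notin> W"
    and f: "\<And>\<sigma>. \<sigma> \<in> matchings W \<Longrightarrow> card \<sigma> = Suc p \<Longrightarrow> f \<sigma> = coboundary h \<sigma>"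
    and k: "\<And>x. x \<in> W \<Longrightarrow> coboundary_on p (W - {x}) (\<lambda>\<tau>. contraction (edge b x) f \<tau> - h \<tau>)"
  obtains H where "\<And>\<sigma>. \<sigma> \<in> matchings W \<Longrightarrow> H \<sigma> = h \<sigma>"
    and "\<And>\<sigma>. \<sigma> \<in> matchings (insert b W) \<Longrightarrow> card \<sigma> = Suc p \<Longrightarrow> f \<sigma> = coboundary H \<sigma>"
proof -
  obtain k where k: "\<And>x \<tau>. x \<in> W \<Longrightarrow> \<tau> \<in> matchings (W - {x}) \<Longrightarrow> card \<tau> = p \<Longrightarrow>
      contraction (edge b x) f \<tau> - h \<tau> = coboundary (k x) \<tau>"
    using k unfolding coboundary_on_def by metis
  obtain H where H: "\<And>\<sigma>. \<sigma> \<in> matchings W \<Longrightarrow> H \<sigma> = h \<sigma>"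
    "\<And>x \<tau>. x \<in> W \<Longrightarrow> \<tau> \<in> matchings (W - {x}) \<Longrightarrow> contraction (edge b x) H \<tau> = - k x \<tau>"
    using glue_cochains[OF b, of h "\<lambda>x \<tau>. - k x \<tau>"] by metis
  show thesis
  proof (rule that[OF H(1)])
    fix \<sigma> assume \<sigma>: "\<sigma> \<in> matchings (insert b W)" "card \<sigma> = Suc p"
    show "f \<sigma> = coboundary H \<sigma>"
    proof (rule matching_induct_edge[OF b _ _ \<sigma>])
      fix \<tau> assume "\<tau> \<in> matchings W" "card \<tau> = Suc p"
      then show "f \<tau> = coboundary H \<tau>"
        using f coboundary_cong[of \<tau> W H h] H(1) by simp
    next
      fix x \<tau> assume x: "x \<in> W" and \<tau>: "\<tau> \<in> matchings (W - {x})" and "Suc (card \<tau>) = Suc p"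
      have "contraction (edge b x) (coboundary H) \<tau> = H \<tau> - coboundary (contraction (edge b x) H) \<tau>"
        using finite_matching[OF \<tau>] insert_edge_link(2)[OF \<tau> b x] by (rule contraction_coboundary)
      also have "H \<tau> = h \<tau>" using H(1) matchings_mono[OF \<tau>] by blast
      also have "coboundary (contraction (edge b x) H) \<tau> = - coboundary (k x) \<tau>"
        unfolding coboundary_uminus[symmetric] by (rule coboundary_cong[OF \<tau>]) (use H(2) x in auto)
      also have "h \<tau> - - coboundary (k x) \<tau> = contraction (edge b x) f \<tau>"
        using k[OF x \<tau>] \<open>Suc (card \<tau>) = Suc p\<close> by (simp add: algebra_simps)
      finally show "contraction (edge b x) f \<tau> = contraction (edge b x) (coboundary H) \<tau>" ..
    qed
  qed (simp_all)
qed

lemma coboundary_on_extend: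
  assumes "b \<notin> W"
    and "\<And>\<sigma>. \<sigma> \<in> matchings W \<Longrightarrow> card \<sigma> = Suc p \<Longrightarrow> f \<sigma> = coboundary h \<sigma>"
    and "\<And>x. x \<in> W \<Longrightarrow> coboundary_on p (W - {x}) (\<lambda>\<tau>. contraction (edge b x) f \<tau> - h \<tau>)"
  shows "coboundary_on (Suc p) (insert b W) f"
  by (rule extend_primitive[OF assms]) (auto simp: coboundary_on_def)

text \<open>
  Cartan's formula for a cocycle: on the link of \<open>b x\<close> its contraction is a primitive of the cocycle
  itself.
\<close>
lemma coboundary_contraction_cocycle:
  assumes f: "cocycle_on (Suc p) (insert b W) f" and b: "b \<notin> W" and x: "x \<in> W"
    and \<tau>: "\<tau> \<in> matchings (W - {x})" "card \<tau> = Suc p"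
  shows "coboundary (contraction (edge b x) f) \<tau> = f \<tau>"
proof -
  have "coboundary f (insert (edge b x) \<tau>) = 0"
    using f insert_edge_link[OF \<tau>(1) b x] \<tau>(2) by (simp add: cocycle_on_def)
  then show ?thesis
    using contraction_coboundary[of \<tau> "edge b x" f] finite_matching[OF \<tau>(1)]
      insert_edge_link(2)[OF \<tau>(1) b x] by (simp add: contraction_def)
qed

lemma contraction_cocycle:
  assumes "cocycle_on (Suc p) (insert b W) f" "b \<notin> W" "x \<in> W"
    and "\<And>\<sigma>. \<sigma> \<in> matchings (W - {x}) \<Longrightarrow> card \<sigma> = Suc p \<Longrightarrow> f \<sigma> = coboundary h \<sigma>"
  shows "cocycle_on p (W - {x}) (\<lambda>\<tau>. contraction (edge b x) f \<tau> - h \<tau>)"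
  using assms coboundary_contraction_cocycle[OF assms(1-3)]
  by (auto simp: cocycle_on_def coboundary_diff)

text \<open>
  Stated as a predicate of the degree, since the lemmas that lead to it use it in smaller degrees.
\<close>
definition acyclic_degree :: "nat \<Rightarrow> 'v::linorder itself \<Rightarrow> 'r::comm_ring_1 itself \<Rightarrow> bool" where
  "acyclic_degree p _ _ \<longleftrightarrow> (\<forall>V (f::('v \<times> 'v) set \<Rightarrow> 'r). finite V \<longrightarrow> 3 * p + 2 \<le> card V \<longrightarrow>
     cocycle_on p V f \<longrightarrow> coboundary_on p V f)"

text \<open>
  A primitive on \<open>W\<close> leaves an obstruction on each link \<open>W - {x}\<close> of one degree less. That link is
  large enough for the obstruction to vanish.
\<close>
lemma coboundary_on_insert_aux:
  fixes f :: "('v::linorder \<times> 'v) set \<Rightarrow> 'r::comm_ring_1"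
  assumes acyclic: "\<And>q. p = Suc q \<Longrightarrow> acyclic_degree q TYPE('v) TYPE('r)"
    and W: "finite W" "b \<notin> W" "3 * p \<le> card W"
    and f: "cocycle_on p (insert b W) f" "coboundary_on p W f"
  shows "coboundary_on p (insert b W) f"
proof (cases p)
  case 0
  then show ?thesis using f(2) by (simp add: coboundary_on_0)
next
  case (Suc q)
  obtain h where h: "\<And>\<sigma>. \<sigma> \<in> matchings W \<Longrightarrow> card \<sigma> = Suc q \<Longrightarrow> f \<sigma> = coboundary h \<sigma>"
    using f(2) Suc unfolding coboundary_on_def by metis
  show ?thesis
    unfolding Suc
  proof (rule coboundary_on_extend[OF W(2) h])
    fix x assume x: "x \<in> W"
    have "cocycle_on q (W - {x}) (\<lambda>\<tau>. contraction (edge b x) f \<tau> - h \<tau>)"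
      by (rule contraction_cocycle[OF f(1)[unfolded Suc] W(2) x], rule h)
        (auto intro: matchings_mono)
    then show "coboundary_on q (W - {x}) (\<lambda>\<tau>. contraction (edge b x) f \<tau> - h \<tau>)"
      using acyclic[OF Suc] W x Suc unfolding acyclic_degree_def by simp
  qed
qed

text \<open>
  Let \<open>g\<close> be the contraction of \<open>f\<close> along \<open>b c\<close>. It is a primitive of \<open>f\<close> where \<open>b\<close> and \<open>c\<close> are
  unmatched. The hypotheses say that the obstructions to extending it to matchings that use just one
  of \<open>b\<close> and \<open>c\<close> vanish. The obstruction on matchings that use both, along different edges, lives on
  \<open>card Z - 2\<close> vertices in degree \<open>p - 1\<close> and vanishes by acyclicity.
\<close>
lemma coboundary_on_pair_aux:
  fixes f :: "('v::linorder \<times> 'v) set \<Rightarrow> 'r::comm_ring_1"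
  assumes acyclic: "\<And>q. p = Suc q \<Longrightarrow> acyclic_degree q TYPE('v) TYPE('r)"
    and Z: "finite Z" "b \<notin> Z" "c \<notin> Z" "b \<noteq> c" "3 * p + 1 \<le> card Z"
    and f: "cocycle_on (Suc p) (insert b (insert c Z)) f"
    and fb: "\<And>x. x \<in> Z \<Longrightarrow> coboundary_on p (Z - {x})
      (\<lambda>\<tau>. contraction (edge b x) f \<tau> - contraction (edge b c) f \<tau>)"
    and fc: "\<And>x. x \<in> Z \<Longrightarrow> coboundary_on p (Z - {x})
      (\<lambda>\<tau>. contraction (edge c x) f \<tau> - contraction (edge b c) f \<tau>)"
  shows "coboundary_on (Suc p) (insert b (insert c Z)) f"
proof -
  let ?g = "contraction (edge b c) f"
  have bW: "b \<notin> insert c Z" using Z by simp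
  have cW: "insert c Z - {c} = Z" using Z by simp
  have g: "f \<sigma> = coboundary ?g \<sigma>" if "\<sigma> \<in> matchings Z" "card \<sigma> = Suc p" for \<sigma>
    using coboundary_contraction_cocycle[OF f bW, of c \<sigma>] that cW by simp
  obtain H where H: "\<And>\<sigma>. \<sigma> \<in> matchings Z \<Longrightarrow> H \<sigma> = ?g \<sigma>"
    "\<And>\<sigma>. \<sigma> \<in> matchings (insert c Z) \<Longrightarrow> card \<sigma> = Suc p \<Longrightarrow> f \<sigma> = coboundary H \<sigma>"
    using extend_primitive[where f = f and h = ?g, OF Z(3) g fc] by metis
  show ?thesis
  proof (rule coboundary_on_extend[OF bW H(2)])
    fix x assume x: "x \<in> insert c Z"
    let ?d = "\<lambda>\<tau>. contraction (edge b x) f \<tau> - H \<tau>"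
    show "coboundary_on p (insert c Z - {x}) ?d"
    proof (cases "x = c")
      case True
      then show ?thesis using H(1) cW by (auto intro!: coboundary_on_zero)
    next
      case False
      then have xZ: "x \<in> Z" and eq: "insert c Z - {x} = insert c (Z - {x})" using x by auto
      have "cocycle_on p (insert c Z - {x}) ?d"
        by (rule contraction_cocycle[OF f bW x], rule H(2)) (auto intro: matchings_mono)
      then have 1: "cocycle_on p (insert c (Z - {x})) ?d" unfolding eq .
      have 2: "coboundary_on p (Z - {x}) ?d"
        by (rule coboundary_on_cong[OF fb[OF xZ]]) (use H(1) matchings_mono in fastforce)
      show ?thesis
        unfolding eq by (rule coboundary_on_insert_aux[OF acyclic _ _ _ 1 2]) (use Z xZ in auto)
    qed
  qed
qed

text \<open>
  Two vertices \<open>b\<close>, \<open>c\<close> are chosen. The contraction of the cocycle along \<open>b c\<close> is a primitive where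
  both are unmatched, and the obstructions to extending it are cocycles that lose at most three
  vertices per degree, so they vanish by induction. In degree \<open>0\<close> a single edge suffices: the
  cocycle condition there says that the value on the empty matching is zero.
\<close>
lemma acyclic_degree: "acyclic_degree p TYPE('v::linorder) TYPE('r::comm_ring_1)"
proof (induction p rule: less_induct)
  case (less p)
  show ?case
    unfolding acyclic_degree_def
  proof (intro allI impI)
    fix V :: "'v set" and f :: "('v \<times> 'v) set \<Rightarrow> 'r"
    assume V: "finite V" "3 * p + 2 \<le> card V" and f: "cocycle_on p V f"
    have "\<not> card V \<le> Suc 0" using V(2) by simp
    then obtain b c where bc: "b \<in> V" "c \<in> V" "b \<noteq> c"
      unfolding card_le_Suc0_iff_eq[OF V(1)] by blast
    define Z where "Z = V - {b, c}"
    have Veq: "V = insert b (insert c Z)" using bc by (auto simp: Z_def)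
    have Z: "finite Z" "b \<notin> Z" "c \<notin> Z" "b \<noteq> c" using bc V by (auto simp: Z_def)
    then have cardZ: "card V = card Z + 2" by (simp add: Veq)
    show "coboundary_on p V f"
    proof (cases p)
      case 0
      have m: "{edge b c} \<in> matchings V"
        using insert_edge_matching[of "{}" Z b c] Z by (simp add: Veq)
      have "coboundary f {edge b c} = 0"
        using f m unfolding cocycle_on_def 0 by simp
      then have "f {} = 0" by (simp add: coboundary_def order_sign_insert_self)
      then show ?thesis by (simp add: 0 coboundary_on_0)
    next
      case (Suc q)
      have acyc: "acyclic_degree q TYPE('v) TYPE('r)" using less Suc by simp
      have fq: "cocycle_on (Suc q) (insert b (insert c Z)) f" using f by (simp add: Veq Suc)
      have *: "coboundary_on q (Z - {x}) (\<lambda>\<tau>. contraction (edge d x) f \<tau> - contraction (edge b c) f \<tau>)"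
        if x: "x \<in> Z" and d: "d = b \<or> d = c" for d x
      proof -
        have dZ: "d \<notin> Z" using d Z by auto
        have "cocycle_on q (Z - {x}) (\<lambda>\<tau>. contraction (edge d x) f \<tau> - contraction (edge b c) f \<tau>)"
        proof (rule contraction_cocycle[OF _ dZ x])
          show "cocycle_on (Suc q) (insert d Z) f"
            by (rule cocycle_on_mono[OF fq]) (use d in auto)
          fix \<sigma> assume \<sigma>: "\<sigma> \<in> matchings (Z - {x})" "card \<sigma> = Suc q"
          have m: "\<sigma> \<in> matchings (insert c Z - {c})" by (rule matchings_mono[OF \<sigma>(1)]) (use Z in auto)
          have bW: "b \<notin> insert c Z" using Z by simp
          show "f \<sigma> = coboundary (contraction (edge b c) f) \<sigma>"
            using coboundary_contraction_cocycle[OF fq bW _ m \<sigma>(2)] by simp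
        qed
        then show ?thesis
          using acyc x Z V cardZ Suc unfolding acyclic_degree_def by simp
      qed
      show ?thesis
        unfolding Veq Suc
      proof (rule coboundary_on_pair_aux[OF _ Z _ fq * *])
        fix r assume "q = Suc r"
        then show "acyclic_degree r TYPE('v) TYPE('r)" using less Suc by simp
      qed (use V cardZ Suc in auto)
    qed
  qed
qed

lemmas coboundary_on_insert = coboundary_on_insert_aux[OF acyclic_degree]

lemmas coboundary_on_pair = coboundary_on_pair_aux[OF acyclic_degree]

section \<open>Evaluation on joins of pairs\<close>

text \<open>
  A list of pairs \<open>(d, e)\<close> stands for the join of the formal differences \<open>d - e\<close>. Its faces arise by
  choosing one element of every pair.
\<close>
fun choices :: "('e \<times> 'e) list \<Rightarrow> 'e set set" where
  "choices [] = {{}}"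
| "choices ((d, e) # R) = insert d ` choices R \<union> insert e ` choices R"

fun join_eval :: "('e::linorder \<times> 'e) list \<Rightarrow> ('e set \<Rightarrow> 'r::comm_ring_1) \<Rightarrow> 'r" where
  "join_eval [] f = f {}"
| "join_eval ((d, e) # R) f = join_eval R (contraction d f) - join_eval R (contraction e f)"

lemma join_eval_cong: "(\<And>\<sigma>. \<sigma> \<in> choices R \<Longrightarrow> f \<sigma> = g \<sigma>) \<Longrightarrow> join_eval R f = join_eval R g"
proof (induction R arbitrary: f g rule: choices.induct)
  case (2 d e R)
  have "join_eval R (contraction x f) = join_eval R (contraction x g)" if "x = d \<or> x = e" for x
    using that by (intro "2.IH") (auto simp: contraction_def "2.prems")
  then show ?case by simp
qed simp

lemma join_eval_diff: "join_eval R (\<lambda>\<sigma>. f \<sigma> - g \<sigma>) = join_eval R f - join_eval R g"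
  by (induction R arbitrary: f g rule: choices.induct) (simp_all add: contraction_diff)

lemma join_eval_scale: "join_eval R (\<lambda>\<sigma>. c * f \<sigma>) = c * join_eval R f"
  by (induction R arbitrary: f rule: choices.induct) (simp_all add: contraction_scale algebra_simps)

text \<open>
  Elements of different pairs are distinct. Two elements of one pair may coincide, the difference
  then being zero.
\<close>
fun separated :: "('e \<times> 'e) list \<Rightarrow> bool" where
  "separated [] \<longleftrightarrow> True"
| "separated ((d, e) # R) \<longleftrightarrow> (\<forall>\<sigma>\<in>choices R. d \<notin> \<sigma> \<and> e \<notin> \<sigma>) \<and> separated R"

lemma finite_choice: "\<sigma> \<in> choices R \<Longrightarrow> finite \<sigma>"
  by (induction R arbitrary: \<sigma> rule: choices.induct) auto

lemma join_eval_contraction_coboundary: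
  assumes "\<forall>\<sigma>\<in>choices R. e \<notin> \<sigma>"
  shows "join_eval R (contraction e (coboundary h)) =
    join_eval R h - join_eval R (coboundary (contraction e h))"
proof -
  have "join_eval R (contraction e (coboundary h)) =
      join_eval R (\<lambda>\<sigma>. h \<sigma> - coboundary (contraction e h) \<sigma>)"
    using assms finite_choice by (intro join_eval_cong contraction_coboundary) auto
  then show ?thesis by (simp add: join_eval_diff)
qed

text \<open>
  A join of differences is a cycle: contracting \<open>\<delta> h\<close> along \<open>d\<close> and along \<open>e\<close> gives \<open>h\<close> both times,
  up to coboundaries, and the two copies cancel.
\<close>
lemma join_eval_coboundary: "separated R \<Longrightarrow> join_eval R (coboundary h) = 0"
  by (induction R arbitrary: h rule: separated.induct)
    (simp_all add: join_eval_contraction_coboundary)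

text \<open>
  Two edges with a common end exclude each other in a matching, so their difference is a reduced
  0-cycle on three vertices. Joins of these cycles represent the homology to be detected.
\<close>
definition fork :: "'v \<times> 'v \<times> 'v \<Rightarrow> ('v::linorder \<times> 'v) \<times> ('v \<times> 'v)" where
  "fork = (\<lambda>(a, b, c). (edge a b, edge a c))"

definition triple_vertices :: "('v \<times> 'v \<times> 'v) list \<Rightarrow> 'v list" where
  "triple_vertices ts = concat (map (\<lambda>(a, b, c). [a, b, c]) ts)"

lemma triple_vertices_simps [simp]:
  "triple_vertices [] = []"
  "triple_vertices ((a, b, c) # ts) = a # b # c # triple_vertices ts"
  by (simp_all add: triple_vertices_def)

lemma fork_simp [simp]: "fork (a, b, c) = (edge a b, edge a c)"
  by (simp add: fork_def)

lemma length_triple_vertices: "length (triple_vertices ts) = 3 * length ts"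
  by (induction ts) auto

lemma choices_fork_matching:
  assumes "distinct (triple_vertices ts)" "\<sigma> \<in> choices (map fork ts)"
  shows "\<sigma> \<in> matchings (set (triple_vertices ts)) \<and> card \<sigma> = length ts"
  using assms
proof (induction ts arbitrary: \<sigma>)
  case (Cons t ts)
  obtain a b c where t: "t = (a, b, c)" by (cases t)
  obtain x \<tau> where x: "x = b \<or> x = c" "\<tau> \<in> choices (map fork ts)" "\<sigma> = insert (edge a x) \<tau>"
    using Cons.prems by (auto simp: t)
  have \<tau>: "\<tau> \<in> matchings (set (triple_vertices ts))" "card \<tau> = length ts"
    using Cons x by (simp_all add: t)
  have ax: "a \<notin> set (triple_vertices ts)" "x \<notin> set (triple_vertices ts)" "a \<noteq> x"
    using Cons.prems x(1) by (auto simp: t)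
  have "\<sigma> \<in> matchings (set (triple_vertices (t # ts)))"
    unfolding x(3) by (rule matchings_mono[OF insert_edge_matching[OF \<tau>(1) ax]]) (use x in \<open>auto simp: t\<close>)
  moreover have "card \<sigma> = length (t # ts)"
    using edge_notin_matching[OF \<tau>(1), of a x] ax finite_matching[OF \<tau>(1)] \<tau>(2) by (simp add: x(3))
  ultimately show ?case ..
qed simp

lemma separated_fork: "distinct (triple_vertices ts) \<Longrightarrow> separated (map fork ts)"
proof (induction ts)
  case (Cons t ts)
  obtain a b c where t: "t = (a, b, c)" by (cases t)
  have "edge a b \<notin> \<sigma> \<and> edge a c \<notin> \<sigma>" if "\<sigma> \<in> choices (map fork ts)" for \<sigma>
    using choices_fork_matching[OF _ that] edge_notin_matching[of \<sigma> _ a] Cons.prems by (auto simp: t)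
  then show ?case using Cons by (simp add: t)
qed simp

lemma join_eval_coboundary_on:
  assumes "distinct (triple_vertices ts)" "length ts = p" "set (triple_vertices ts) \<subseteq> V" "coboundary_on p V f"
  shows "join_eval (map fork ts) f = 0"
proof -
  obtain h where h: "\<And>\<sigma>. \<sigma> \<in> matchings V \<Longrightarrow> card \<sigma> = p \<Longrightarrow> f \<sigma> = coboundary h \<sigma>"
    using assms(4) unfolding coboundary_on_def by metis
  have "join_eval (map fork ts) f = join_eval (map fork ts) (coboundary h)"
    using choices_fork_matching[OF assms(1)] assms(2,3) by (intro join_eval_cong h) (auto intro: matchings_mono)
  then show ?thesis using join_eval_coboundary[OF separated_fork[OF assms(1)]] by simp
qed

section \<open>The classes modulo 3\<close>

text \<open>
  The cocycle is prescribed by contractions: \<open>u x\<close> along \<open>b x\<close>, \<open>- u x\<close> along \<open>c x\<close>, and zero along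
  \<open>b c\<close> and on matchings that avoid \<open>b\<close> and \<open>c\<close>. On matchings that contain \<open>b x\<close> and \<open>c y\<close> the
  cocycle condition asks for a primitive of \<open>u x + u y\<close>.
\<close>
lemma extend_cocycle_pair:
  fixes u :: "'v::linorder \<Rightarrow> ('v \<times> 'v) set \<Rightarrow> 'r::comm_ring_1"
  assumes Z: "b \<notin> Z" "c \<notin> Z" "b \<noteq> c"
    and u: "\<And>x. x \<in> Z \<Longrightarrow> cocycle_on p (Z - {x}) (u x)"
    and uu: "\<And>x y. x \<in> Z \<Longrightarrow> y \<in> Z \<Longrightarrow> x \<noteq> y \<Longrightarrow>
      coboundary_on p (Z - {x} - {y}) (\<lambda>\<sigma>. u x \<sigma> + u y \<sigma>)"
  obtains f where "cocycle_on (Suc p) (insert b (insert c Z)) f"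
    and "\<And>\<tau>. \<tau> \<in> matchings Z \<Longrightarrow> contraction (edge b c) f \<tau> = 0"
    and "\<And>x \<tau>. x \<in> Z \<Longrightarrow> \<tau> \<in> matchings (Z - {x}) \<Longrightarrow> contraction (edge b x) f \<tau> = u x \<tau>"
    and "\<And>x \<tau>. x \<in> Z \<Longrightarrow> \<tau> \<in> matchings (Z - {x}) \<Longrightarrow> contraction (edge c x) f \<tau> = - u x \<tau>"
proof -
  \<comment> \<open>The vertex \<open>c\<close> is added first, with \<open>b\<close> unmatched.\<close>
  obtain f1 where f1: "\<And>\<sigma>. \<sigma> \<in> matchings Z \<Longrightarrow> f1 \<sigma> = 0"
    "\<And>x \<tau>. x \<in> Z \<Longrightarrow> \<tau> \<in> matchings (Z - {x}) \<Longrightarrow> contraction (edge c x) f1 \<tau> = - u x \<tau>"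
    using glue_cochains[OF Z(2), of "\<lambda>_. 0" "\<lambda>x \<tau>. - u x \<tau>"] by metis
  \<comment> \<open>Contracting along \<open>b x\<close> must give a primitive of \<open>f1\<close> that restricts to \<open>u x\<close>.\<close>
  have "\<exists>K. (\<forall>\<tau>\<in>matchings (Z - {x}). K \<tau> = u x \<tau>) \<and>
      (\<forall>\<tau>\<in>matchings (insert c (Z - {x})). card \<tau> = Suc p \<longrightarrow> f1 \<tau> = coboundary K \<tau>)"
    if x: "x \<in> Z" for x
  proof (rule extend_primitive[of c "Z - {x}" p f1 "u x"])
    show "c \<notin> Z - {x}" using Z by simp
  next
    fix \<sigma> assume "\<sigma> \<in> matchings (Z - {x})" "card \<sigma> = Suc p"
    then show "f1 \<sigma> = coboundary (u x) \<sigma>"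
      using u[OF x] f1(1) matchings_mono[of \<sigma> "Z - {x}" Z] by (auto simp: cocycle_on_def)
  next
    fix y assume y: "y \<in> Z - {x}"
    have "coboundary_on p (Z - {x} - {y}) (\<lambda>\<tau>. (-1) * (u x \<tau> + u y \<tau>))"
      using y x by (intro coboundary_on_scale uu) auto
    then show "coboundary_on p (Z - {x} - {y}) (\<lambda>\<tau>. contraction (edge c y) f1 \<tau> - u x \<tau>)"
    proof (rule coboundary_on_cong)
      fix \<sigma> assume "\<sigma> \<in> matchings (Z - {x} - {y})"
      then have "\<sigma> \<in> matchings (Z - {y})" by (rule matchings_mono) auto
      then show "contraction (edge c y) f1 \<sigma> - u x \<sigma> = - 1 * (u x \<sigma> + u y \<sigma>)"
        using f1(2)[of y \<sigma>] y by simp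
    qed
  qed blast
  then obtain K where K: "\<And>x \<tau>. x \<in> Z \<Longrightarrow> \<tau> \<in> matchings (Z - {x}) \<Longrightarrow> K x \<tau> = u x \<tau>"
    "\<And>x \<tau>. x \<in> Z \<Longrightarrow> \<tau> \<in> matchings (insert c (Z - {x})) \<Longrightarrow> card \<tau> = Suc p \<Longrightarrow>
      f1 \<tau> = coboundary (K x) \<tau>"
    by metis
  have bW: "b \<notin> insert c Z" using Z by simp
  obtain f where f: "\<And>\<sigma>. \<sigma> \<in> matchings (insert c Z) \<Longrightarrow> f \<sigma> = f1 \<sigma>"
    "\<And>x \<tau>. x \<in> insert c Z \<Longrightarrow> \<tau> \<in> matchings (insert c Z - {x}) \<Longrightarrow>
      contraction (edge b x) f \<tau> = (if x = c then 0 else K x \<tau>)"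
    using glue_cochains[OF bW, of f1 "\<lambda>x \<tau>. if x = c then 0 else K x \<tau>"] by metis
  have f1_cocycle: "coboundary f1 \<sigma> = 0" if \<sigma>: "\<sigma> \<in> matchings (insert c Z)" "card \<sigma> = Suc (Suc p)" for \<sigma>
  proof (rule matching_induct_edge[OF Z(2) _ _ \<sigma>, where g = "\<lambda>_. 0"])
    fix \<sigma> assume "\<sigma> \<in> matchings Z"
    then have "coboundary f1 \<sigma> = coboundary (\<lambda>_. 0) \<sigma>"
      by (rule coboundary_cong) (simp add: f1(1))
    then show "coboundary f1 \<sigma> = 0" by simp
  next
    fix x \<tau> assume x: "x \<in> Z" and \<tau>: "\<tau> \<in> matchings (Z - {x})" and card: "Suc (card \<tau>) = Suc (Suc p)"
    have "contraction (edge c x) (coboundary f1) \<tau> = f1 \<tau> - coboundary (contraction (edge c x) f1) \<tau>"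
      using finite_matching[OF \<tau>] insert_edge_link(2)[OF \<tau> Z(2) x] by (rule contraction_coboundary)
    also have "f1 \<tau> = 0" using f1(1) matchings_mono[OF \<tau>] by blast
    also have "coboundary (contraction (edge c x) f1) \<tau> = coboundary (\<lambda>\<tau>. - u x \<tau>) \<tau>"
      by (rule coboundary_cong[OF \<tau>]) (simp add: f1(2) x)
    also have "\<dots> = 0"
      using u[OF x] \<tau> card by (simp add: coboundary_uminus cocycle_on_def)
    finally show "contraction (edge c x) (coboundary f1) \<tau> = contraction (edge c x) (\<lambda>_. 0) \<tau>"
      by (simp add: contraction_def)
  qed
  show thesis
  proof (rule that)
    show "cocycle_on (Suc p) (insert b (insert c Z)) f"
      unfolding cocycle_on_def
    proof (intro ballI impI)
      fix \<sigma> assume \<sigma>: "\<sigma> \<in> matchings (insert b (insert c Z))" "card \<sigma> = Suc (Suc p)"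
      show "coboundary f \<sigma> = 0"
      proof (rule matching_induct_edge[OF bW _ _ \<sigma>, where g = "\<lambda>_. 0"])
        fix \<sigma> assume \<sigma>: "\<sigma> \<in> matchings (insert c Z)" "card \<sigma> = Suc (Suc p)"
        have "coboundary f \<sigma> = coboundary f1 \<sigma>" by (rule coboundary_cong[OF \<sigma>(1)]) (simp add: f(1))
        then show "coboundary f \<sigma> = 0" using f1_cocycle[OF \<sigma>] by simp
      next
        fix x \<tau> assume x: "x \<in> insert c Z" and \<tau>: "\<tau> \<in> matchings (insert c Z - {x})"
          and card: "Suc (card \<tau>) = Suc (Suc p)"
        have "contraction (edge b x) (coboundary f) \<tau> = f \<tau> - coboundary (contraction (edge b x) f) \<tau>"
          using finite_matching[OF \<tau>] insert_edge_link(2)[OF \<tau> bW x] by (rule contraction_coboundary)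
        also have "f \<tau> = f1 \<tau>" using f(1) matchings_mono[OF \<tau>] by blast
        also have "coboundary (contraction (edge b x) f) \<tau> = coboundary (\<lambda>\<tau>. if x = c then 0 else K x \<tau>) \<tau>"
          by (rule coboundary_cong[OF \<tau>]) (rule f(2)[OF x])
        also have "\<dots> = f1 \<tau>"
        proof (cases "x = c")
          case True
          then have "\<tau> \<in> matchings Z" using \<tau> Z by simp
          then show ?thesis using f1(1) True by simp
        next
          case False
          then have "insert c Z - {x} = insert c (Z - {x})" by auto
          then show ?thesis using False K(2)[of x \<tau>] x \<tau> card by simp
        qed
        finally show "contraction (edge b x) (coboundary f) \<tau> = contraction (edge b x) (\<lambda>_. 0) \<tau>"
          by (simp add: contraction_def)
      qed
    qed
  next
    fix \<tau> assume "\<tau> \<in> matchings Z"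
    then show "contraction (edge b c) f \<tau> = 0" using f(2)[of c \<tau>] Z by simp
  next
    fix x \<tau> assume x: "x \<in> Z" and \<tau>: "\<tau> \<in> matchings (Z - {x})"
    have "\<tau> \<in> matchings (insert c Z - {x})" by (rule matchings_mono[OF \<tau>]) auto
    then show "contraction (edge b x) f \<tau> = u x \<tau>"
      using f(2)[of x \<tau>] K(1)[OF x \<tau>] x Z by auto
  next
    fix x \<tau> assume x: "x \<in> Z" and \<tau>: "\<tau> \<in> matchings (Z - {x})"
    show "contraction (edge c x) f \<tau> = - u x \<tau>"
      using f(1)[OF insert_edge_link(1)[OF \<tau> Z(2) x]] f1(2)[OF x \<tau>] by (simp add: contraction_def)
  qed
qed

text \<open>
  One class for every set of \<open>3 p + 1\<close> vertices. The second condition is naturality: if one vertex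
  is exchanged for another, the classes agree on the common \<open>3 p\<close> vertices. The sign that moves the
  exchanged vertex to the front compares the orientations, so that the family behaves like a section
  of the orientation line of the vertex set.
\<close>
definition bottom_family ::
    "nat \<Rightarrow> ('v::linorder set \<Rightarrow> ('v \<times> 'v) set \<Rightarrow> 'r::comm_ring_1) \<Rightarrow> bool" where
  "bottom_family p \<phi> \<longleftrightarrow>
     (\<forall>V. finite V \<longrightarrow> card V = 3 * p + 1 \<longrightarrow> cocycle_on p V (\<phi> V)) \<and>
     (\<forall>W x y. finite W \<longrightarrow> card W = 3 * p \<longrightarrow> x \<notin> W \<longrightarrow> y \<notin> W \<longrightarrow>
        coboundary_on p W (\<lambda>\<sigma>. order_sign x W * \<phi> (insert x W) \<sigma> - order_sign y W * \<phi> (insert y W) \<sigma>))"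

lemma bottom_family_cocycle:
  "bottom_family p \<phi> \<Longrightarrow> finite V \<Longrightarrow> card V = 3 * p + 1 \<Longrightarrow> cocycle_on p V (\<phi> V)"
  by (simp add: bottom_family_def)

lemma bottom_family_compare:
  fixes \<phi> :: "'v::linorder set \<Rightarrow> ('v \<times> 'v) set \<Rightarrow> 'r::comm_ring_1"
  assumes \<phi>: "bottom_family p \<phi>" and Q: "finite Q" "card Q = 3 * p" "x \<notin> Q" "y \<notin> Q"
    and \<alpha>\<beta>: "\<alpha> * order_sign x Q = \<beta> * order_sign y Q"
  shows "coboundary_on p Q (\<lambda>\<sigma>. \<alpha> * \<phi> (insert x Q) \<sigma> - \<beta> * \<phi> (insert y Q) \<sigma>)"
proof -
  let ?k = "\<alpha> * order_sign x Q"
  have "coboundary_on p Q (\<lambda>\<sigma>. ?k *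
      (order_sign x Q * \<phi> (insert x Q) \<sigma> - order_sign y Q * \<phi> (insert y Q) \<sigma>))"
    using \<phi> Q unfolding bottom_family_def by (intro coboundary_on_scale) blast
  moreover have "?k * order_sign x Q = \<alpha>" by (simp add: mult.assoc)
  moreover have "?k * order_sign y Q = \<beta>" by (simp add: \<alpha>\<beta> mult.assoc)
  ultimately show ?thesis by (simp add: right_diff_distrib flip: mult.assoc)
qed

text \<open>
  The inductive step of the construction. The product of the first two signs compares the increasing
  order of \<open>V\<close> with the order that starts with \<open>b\<close>, \<open>c\<close>; the third one moves \<open>x\<close> to the front of
  what remains.
\<close>
definition pair_extension ::
    "nat \<Rightarrow> ('v::linorder set \<Rightarrow> ('v \<times> 'v) set \<Rightarrow> 'r::comm_ring_1) \<Rightarrow> 'v set \<Rightarrow> 'v \<Rightarrow> 'v \<Rightarrow>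
      (('v \<times> 'v) set \<Rightarrow> 'r) \<Rightarrow> bool" where
  "pair_extension p \<phi> V b c f \<longleftrightarrow> b \<in> V \<and> c \<in> V \<and> b \<noteq> c \<and> cocycle_on (Suc p) V f \<and>
     (\<forall>\<tau>\<in>matchings (V - {b} - {c}). contraction (edge b c) f \<tau> = 0) \<and>
     (\<forall>x\<in>V - {b} - {c}. \<forall>\<tau>\<in>matchings (V - {b} - {c} - {x}).
        let z = order_sign b (V - {b}) * order_sign c (V - {b} - {c}) * order_sign x (V - {b} - {c} - {x})
          * \<phi> (V - {b} - {c} - {x}) \<tau>
        in contraction (edge b x) f \<tau> = z \<and> contraction (edge c x) f \<tau> = - z)"

lemma pair_extension_contractions:
  fixes \<phi> :: "'v::linorder set \<Rightarrow> ('v \<times> 'v) set \<Rightarrow> 'r::comm_ring_1"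
  assumes "pair_extension p \<phi> (insert b (insert c (insert x Q))) b c f"
    and "b \<notin> insert x Q" "c \<notin> insert x Q" "x \<notin> Q" "\<tau> \<in> matchings Q"
  shows "contraction (edge b x) f \<tau> = order_sign b (insert c (insert x Q)) *
      order_sign c (insert x Q) * order_sign x Q * \<phi> Q \<tau>"
    and "contraction (edge c x) f \<tau> = - (order_sign b (insert c (insert x Q)) *
      order_sign c (insert x Q) * order_sign x Q * \<phi> Q \<tau>)"
proof -
  have bc: "b \<noteq> c" using assms(1) by (simp add: pair_extension_def)
  have "insert b (insert c (insert x Q)) - {b} = insert c (insert x Q)"
    "insert c (insert x Q) - {c} = insert x Q" "insert x Q - {x} = Q"
    using assms bc by auto
  then show "contraction (edge b x) f \<tau> = order_sign b (insert c (insert x Q)) *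
      order_sign c (insert x Q) * order_sign x Q * \<phi> Q \<tau>"
    and "contraction (edge c x) f \<tau> = - (order_sign b (insert c (insert x Q)) *
      order_sign c (insert x Q) * order_sign x Q * \<phi> Q \<tau>)"
    using assms(1,5) unfolding pair_extension_def by (simp_all add: Let_def)
qed

lemma pair_extension_contraction_pair:
  assumes "pair_extension p \<phi> (insert b (insert c Z)) b c f" "b \<notin> Z" "c \<notin> Z" "\<tau> \<in> matchings Z"
  shows "contraction (edge b c) f \<tau> = 0"
proof -
  have "insert b (insert c Z) - {b} = insert c Z" "insert c Z - {c} = Z"
    using assms by (auto simp: pair_extension_def)
  then show ?thesis using assms(1,4) unfolding pair_extension_def by simp
qed

lemma pair_extension_cocycle: "pair_extension p \<phi> V b c f \<Longrightarrow> cocycle_on (Suc p) V f"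
  by (simp add: pair_extension_def)

text \<open>
  The contraction along \<open>b c\<close>, which is zero, is a primitive of \<open>f\<close> there.
\<close>
lemma pair_extension_unmatched:
  assumes f: "pair_extension p \<phi> (insert b (insert c Z)) b c f" and Z: "b \<notin> Z" "c \<notin> Z"
    and \<sigma>: "\<sigma> \<in> matchings Z" "card \<sigma> = Suc p"
  shows "f \<sigma> = 0"
proof -
  have "c \<noteq> b" using f by (auto simp: pair_extension_def)
  then have "coboundary (contraction (edge b c) f) \<sigma> = f \<sigma>"
    using coboundary_contraction_cocycle[OF pair_extension_cocycle[OF f], of c \<sigma>] Z \<sigma> by simp
  moreover have "coboundary (contraction (edge b c) f) \<sigma> = coboundary (\<lambda>_. 0) \<sigma>"
    by (rule coboundary_cong[OF \<sigma>(1)]) (rule pair_extension_contraction_pair[OF f Z])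
  ultimately show ?thesis by simp
qed

text \<open>
  The classes on \<open>Z - {x}\<close> and \<open>Z - {y}\<close> agree on their overlap, and the signs of \<open>x\<close> and \<open>y\<close> differ
  by one exchange. So their sum is a coboundary, as the construction requires.
\<close>
lemma pair_extension_exists:
  fixes \<phi> :: "'v::linorder set \<Rightarrow> ('v \<times> 'v) set \<Rightarrow> 'r::comm_ring_1"
  assumes \<phi>: "bottom_family p \<phi>" and V: "finite V" "card V = 3 * Suc p + 1" and bc: "b \<in> V" "c \<in> V" "b \<noteq> c"
  obtains f where "pair_extension p \<phi> V b c f"
proof -
  define Z where "Z = V - {b} - {c}"
  define u where "u x \<tau> = order_sign b (V - {b}) * order_sign c Z * order_sign x (Z - {x}) * \<phi> (Z - {x}) \<tau>" for x \<tau>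
  have Z: "b \<notin> Z" "c \<notin> Z" "b \<noteq> c" "finite Z" using bc V by (auto simp: Z_def)
  have Veq: "V = insert b (insert c Z)" using bc by (auto simp: Z_def)
  have cardZ: "card Z = 3 * p + 2" using V Z by (simp add: Veq)
  have u: "cocycle_on p (Z - {x}) (u x)" if "x \<in> Z" for x
    unfolding u_def using that Z cardZ
    by (intro cocycle_on_scale bottom_family_cocycle[OF \<phi>]) auto
  have uu: "coboundary_on p (Z - {x} - {y}) (\<lambda>\<sigma>. u x \<sigma> + u y \<sigma>)"
    if xy: "x \<in> Z" "y \<in> Z" "x \<noteq> y" for x y
  proof -
    define Q where "Q = Z - {x} - {y}"
    have Q: "Z - {x} = insert y Q" "Z - {y} = insert x Q" "finite Q" "x \<notin> Q" "y \<notin> Q" "card Q = 3 * p"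
      using xy Z cardZ by (auto simp: Q_def)
    let ?e = "order_sign b (V - {b}) * order_sign c Z :: 'r"
    have "coboundary_on p Q (\<lambda>\<sigma>. (?e * order_sign x (insert y Q)) * \<phi> (insert y Q) \<sigma> -
        (- (?e * order_sign y (insert x Q))) * \<phi> (insert x Q) \<sigma>)"
      using xy Q swap_sign_antisym[OF xy(3), where 'r = 'r]
      by (intro bottom_family_compare[OF \<phi>]) (simp_all add: order_sign_insert algebra_simps)
    then show ?thesis unfolding Q_def[symmetric] unfolding u_def Q(1,2) by simp
  qed
  show thesis
  proof (rule extend_cocycle_pair[of b Z c p u, OF Z(1-3) u uu])
    fix f assume "cocycle_on (Suc p) (insert b (insert c Z)) f"
      "\<And>\<tau>. \<tau> \<in> matchings Z \<Longrightarrow> contraction (edge b c) f \<tau> = 0"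
      "\<And>x \<tau>. x \<in> Z \<Longrightarrow> \<tau> \<in> matchings (Z - {x}) \<Longrightarrow> contraction (edge b x) f \<tau> = u x \<tau>"
      "\<And>x \<tau>. x \<in> Z \<Longrightarrow> \<tau> \<in> matchings (Z - {x}) \<Longrightarrow> contraction (edge c x) f \<tau> = - u x \<tau>"
    then have "pair_extension p \<phi> V b c f"
      using bc by (simp add: pair_extension_def Veq[symmetric] Z_def[symmetric] u_def Let_def)
    then show thesis by (rule that)
  qed
qed

lemma pair_extension_commute:
  fixes \<phi> :: "'v::linorder set \<Rightarrow> ('v \<times> 'v) set \<Rightarrow> 'r::comm_ring_1"
  assumes f: "pair_extension p \<phi> V b c f" and V: "finite V"
  shows "pair_extension p \<phi> V c b f"
proof -
  define Z where "Z = V - {b} - {c}"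
  have bc: "b \<in> V" "c \<in> V" "b \<noteq> c" using f by (auto simp: pair_extension_def)
  then have Z: "V - {c} - {b} = Z" "V - {b} = insert c Z" "V - {c} = insert b Z" "finite Z" "b \<notin> Z" "c \<notin> Z"
    using V by (auto simp: Z_def)
  have "order_sign c (insert b Z) * order_sign b Z = - (order_sign b (insert c Z) * order_sign c Z :: 'r)"
    using Z swap_sign_antisym[OF bc(3), where 'r = 'r] by (simp add: order_sign_insert algebra_simps)
  then have sign: "order_sign c (V - {c}) * order_sign b (V - {b} - {c}) =
      - (order_sign b (V - {b}) * order_sign c (V - {b} - {c}) :: 'r)"
    using Z by (simp add: Z_def[symmetric])
  have comm: "V - {c} - {b} = V - {b} - {c}" by auto
  show ?thesis
    using f unfolding pair_extension_def comm edge_commute[of c b] sign by (auto simp: Let_def)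
qed

text \<open>
  Both cocycles are restricted to the complement of \<open>c\<close> and compared through the pair \<open>b\<close>, \<open>d\<close>. On
  the link \<open>Q\<close> of an edge \<open>b x\<close> all contractions are multiples of one natural class \<open>\<theta>\<close>: \<open>f\<close>
  contributes \<open>\<theta>\<close> along \<open>b x\<close> and \<open>- \<theta>\<close> along \<open>b d\<close>, while \<open>- g\<close> contributes \<open>- \<theta>\<close> along \<open>b d\<close> and
  nothing along \<open>b x\<close>. The obstruction is the difference of the two totals, \<open>3 \<theta>\<close>. The edges \<open>d x\<close>
  are treated in the same way.
\<close>
lemma pair_extension_change_vertex:
  fixes \<phi> :: "'v::linorder set \<Rightarrow> ('v \<times> 'v) set \<Rightarrow> 'r::comm_ring_1"
  assumes three: "(3 :: 'r) = 0" and \<phi>: "bottom_family p \<phi>"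
    and Y: "finite Y" "card Y = 3 * p + 1" "b \<notin> Y" "c \<notin> Y" "d \<notin> Y" "b \<noteq> c" "b \<noteq> d" "c \<noteq> d"
    and f: "pair_extension p \<phi> (insert b (insert c (insert d Y))) b c f"
    and g: "pair_extension p \<phi> (insert b (insert c (insert d Y))) d c g"
  shows "coboundary_on (Suc p) (insert b (insert c (insert d Y))) (\<lambda>\<sigma>. f \<sigma> - g \<sigma>)"
proof -
  let ?F = "\<lambda>\<sigma>. f \<sigma> - g \<sigma>" and ?U = "insert b (insert d Y)"
  have Vc: "insert b (insert c (insert d Y)) = insert c ?U" by auto
  have g': "pair_extension p \<phi> (insert d (insert c (insert b Y))) d c g"
    using g by (simp add: insert_commute)
  have F: "cocycle_on (Suc p) (insert c ?U) ?F"
    unfolding Vc[symmetric] by (intro cocycle_on_diff pair_extension_cocycle[OF f] pair_extension_cocycle[OF g])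
  have key: "coboundary_on p (Y - {x}) (\<lambda>\<tau>. contraction (edge b x) ?F \<tau> - contraction (edge b d) ?F \<tau>)"
    "coboundary_on p (Y - {x}) (\<lambda>\<tau>. contraction (edge d x) ?F \<tau> - contraction (edge b d) ?F \<tau>)"
    if x: "x \<in> Y" for x
  proof -
    define Q where "Q = Y - {x}"
    have Q: "Y = insert x Q" "x \<notin> Q" "finite Q" "card Q = 3 * p" "b \<notin> Q" "c \<notin> Q" "d \<notin> Q"
      "x \<noteq> b" "x \<noteq> c" "x \<noteq> d"
      using x Y by (auto simp: Q_def)
    have f1: "pair_extension p \<phi> (insert b (insert c (insert x (insert d Q)))) b c f"
      and f2: "pair_extension p \<phi> (insert b (insert c (insert d (insert x Q)))) b c f"
      and g1: "pair_extension p \<phi> (insert d (insert c (insert x (insert b Q)))) d c g"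
      and g2: "pair_extension p \<phi> (insert d (insert c (insert b (insert x Q)))) d c g"
      using f g' unfolding Q(1) by (simp_all add: insert_commute)
    define \<alpha> where "\<alpha> = order_sign b (insert c (insert d (insert x Q))) * (order_sign c (insert d (insert x Q)) :: 'r)"
    define \<beta> where "\<beta> = order_sign d (insert c (insert b (insert x Q))) * (order_sign c (insert b (insert x Q)) :: 'r)"
    have cf: "contraction (edge b x) f \<tau> = \<alpha> * order_sign x (insert d Q) * \<phi> (insert d Q) \<tau>"
      "contraction (edge b d) f \<tau> = \<alpha> * order_sign d (insert x Q) * \<phi> (insert x Q) \<tau>"
      "contraction (edge d x) g \<tau> = \<beta> * order_sign x (insert b Q) * \<phi> (insert b Q) \<tau>"
      "contraction (edge b d) g \<tau> = \<beta> * order_sign b (insert x Q) * \<phi> (insert x Q) \<tau>"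
      if \<tau>: "\<tau> \<in> matchings Q" for \<tau>
    proof -
      have m: "\<tau> \<in> matchings (insert d Q)" "\<tau> \<in> matchings (insert x Q)" "\<tau> \<in> matchings (insert b Q)"
        using \<tau> by (auto intro: matchings_mono)
      show "contraction (edge b x) f \<tau> = \<alpha> * order_sign x (insert d Q) * \<phi> (insert d Q) \<tau>"
        using pair_extension_contractions(1)[OF f1 _ _ _ m(1)] Q Y by (simp add: \<alpha>_def insert_commute)
      show "contraction (edge b d) f \<tau> = \<alpha> * order_sign d (insert x Q) * \<phi> (insert x Q) \<tau>"
        using pair_extension_contractions(1)[OF f2 _ _ _ m(2)] Q Y by (simp add: \<alpha>_def)
      show "contraction (edge d x) g \<tau> = \<beta> * order_sign x (insert b Q) * \<phi> (insert b Q) \<tau>"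
        using pair_extension_contractions(1)[OF g1 _ _ _ m(3)] Q Y by (simp add: \<beta>_def insert_commute)
      show "contraction (edge b d) g \<tau> = \<beta> * order_sign b (insert x Q) * \<phi> (insert x Q) \<tau>"
        using pair_extension_contractions(1)[OF g2 _ _ _ m(2)] Q Y
        by (simp add: \<beta>_def edge_commute[of b d])
    qed
    have zero: "contraction (edge b x) g \<tau> = 0" "contraction (edge d x) f \<tau> = 0"
      if \<tau>: "\<tau> \<in> matchings Q" "card \<tau> = p" for \<tau>
    proof -
      have \<tau>': "\<tau> \<in> matchings (Y - {x})" using \<tau> by (simp add: Q_def)
      note m = insert_edge_link[OF \<tau>' Y(3) x] insert_edge_link[OF \<tau>' Y(5) x]
      have "g (insert (edge b x) \<tau>) = 0"
        by (rule pair_extension_unmatched[OF g']) (use m Y \<tau> in auto)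
      moreover have "f (insert (edge d x) \<tau>) = 0"
        by (rule pair_extension_unmatched[OF f]) (use m Y \<tau> in auto)
      ultimately show "contraction (edge b x) g \<tau> = 0" "contraction (edge d x) f \<tau> = 0"
        by (simp_all add: contraction_def)
    qed
    \<comment> \<open>The orientations of the two extensions differ by an odd number of exchanges.\<close>
    have sgn: "\<alpha> * swap_sign x d * order_sign d Q = - (\<beta> * swap_sign x b * order_sign b Q)"
      unfolding \<alpha>_def \<beta>_def using Q Y
        swap_sign_antisym[OF Q(8), where 'r = 'r] swap_sign_antisym[OF Q(10), where 'r = 'r]
        swap_sign_antisym[OF Y(6), where 'r = 'r] swap_sign_antisym[OF Y(7), where 'r = 'r]
        swap_sign_antisym[OF Y(8), where 'r = 'r]
      by (simp add: order_sign_insert mult_ac)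
    have anti: "swap_sign d x = - (swap_sign x d :: 'r)" "swap_sign b x = - (swap_sign x b :: 'r)"
      using Q by (auto intro: swap_sign_antisym)
    have double: "2 * z = - z" for z :: 'r
    proof -
      have "2 * z + z = 3 * z" by simp
      then show ?thesis using three by (simp add: eq_neg_iff_add_eq_0)
    qed
    have "coboundary_on p Q (\<lambda>\<tau>. (\<alpha> * order_sign x (insert d Q)) * \<phi> (insert d Q) \<tau> -
        (\<alpha> * order_sign d (insert x Q) - \<beta> * order_sign b (insert x Q)) * \<phi> (insert x Q) \<tau>)"
    proof (rule bottom_family_compare[OF \<phi>])
      have "\<alpha> * order_sign x (insert d Q) * order_sign d Q -
          (\<alpha> * order_sign d (insert x Q) - \<beta> * order_sign b (insert x Q)) * order_sign x Q
          = order_sign x Q * (2 * (\<alpha> * swap_sign x d * order_sign d Q) - \<beta> * swap_sign x b * order_sign b Q)"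
        using Q anti by (simp add: order_sign_insert algebra_simps)
      then show "\<alpha> * order_sign x (insert d Q) * order_sign d Q =
          (\<alpha> * order_sign d (insert x Q) - \<beta> * order_sign b (insert x Q)) * order_sign x Q"
        unfolding sgn double by simp
    qed (use Q in auto)
    then show "coboundary_on p (Y - {x}) (\<lambda>\<tau>. contraction (edge b x) ?F \<tau> - contraction (edge b d) ?F \<tau>)"
      unfolding Q_def[symmetric]
      by (rule coboundary_on_cong) (use cf zero in \<open>simp add: contraction_diff algebra_simps\<close>)
    have "coboundary_on p Q (\<lambda>\<tau>. (- \<beta> * order_sign x (insert b Q)) * \<phi> (insert b Q) \<tau> -
        (\<alpha> * order_sign d (insert x Q) - \<beta> * order_sign b (insert x Q)) * \<phi> (insert x Q) \<tau>)"
    proof (rule bottom_family_compare[OF \<phi>])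
      have "- \<beta> * order_sign x (insert b Q) * order_sign b Q -
          (\<alpha> * order_sign d (insert x Q) - \<beta> * order_sign b (insert x Q)) * order_sign x Q
          = order_sign x Q * (\<alpha> * swap_sign x d * order_sign d Q - 2 * (\<beta> * swap_sign x b * order_sign b Q))"
        using Q anti by (simp add: order_sign_insert algebra_simps)
      then show "- \<beta> * order_sign x (insert b Q) * order_sign b Q =
          (\<alpha> * order_sign d (insert x Q) - \<beta> * order_sign b (insert x Q)) * order_sign x Q"
        unfolding sgn double by simp
    qed (use Q in auto)
    then show "coboundary_on p (Y - {x}) (\<lambda>\<tau>. contraction (edge d x) ?F \<tau> - contraction (edge b d) ?F \<tau>)"
      unfolding Q_def[symmetric]
      by (rule coboundary_on_cong) (use cf zero in \<open>simp add: contraction_diff algebra_simps\<close>)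
  qed
  have "coboundary_on (Suc p) ?U ?F"
    by (rule coboundary_on_pair[OF _ _ _ _ _ _ key])
      (use Y F in \<open>auto intro: cocycle_on_mono\<close>)
  then show ?thesis
    unfolding Vc by (intro coboundary_on_insert[OF _ _ _ F]) (use Y in auto)
qed

text \<open>
  Naturality in the next degree, for extensions through a common pair: along the edges at \<open>b\<close> and
  \<open>c\<close> it is naturality of \<open>\<phi>\<close>, multiplied by the sign of moving \<open>x\<close> and \<open>y\<close> past \<open>b\<close>, \<open>c\<close> and \<open>z\<close>.
\<close>
lemma pair_extension_restrict_compare:
  fixes \<phi> :: "'v::linorder set \<Rightarrow> ('v \<times> 'v) set \<Rightarrow> 'r::comm_ring_1"
  assumes \<phi>: "bottom_family p \<phi>"
    and W: "finite W" "card W = 3 * Suc p" "x \<notin> W" "y \<notin> W" "b \<in> W" "c \<in> W" "b \<noteq> c"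
    and f: "pair_extension p \<phi> (insert x W) b c f" and g: "pair_extension p \<phi> (insert y W) b c g"
  shows "coboundary_on (Suc p) W (\<lambda>\<sigma>. order_sign x W * f \<sigma> - order_sign y W * g \<sigma>)"
proof -
  define Z where "Z = W - {b} - {c}"
  have Z: "W = insert b (insert c Z)" "b \<notin> Z" "c \<notin> Z" "finite Z" "card Z = 3 * p + 1"
    "x \<notin> Z" "y \<notin> Z" "x \<noteq> b" "x \<noteq> c" "y \<noteq> b" "y \<noteq> c"
    using W by (auto simp: Z_def)
  let ?F = "\<lambda>\<sigma>. order_sign x W * f \<sigma> - order_sign y W * g \<sigma>"
  have F: "cocycle_on (Suc p) W ?F"
    using pair_extension_cocycle[OF f] pair_extension_cocycle[OF g]
    by (intro cocycle_on_diff cocycle_on_scale) (auto intro: cocycle_on_mono)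
  have f0: "pair_extension p \<phi> (insert b (insert c (insert x Z))) b c f"
    and g0: "pair_extension p \<phi> (insert b (insert c (insert y Z))) b c g"
    using f g Z by (simp_all add: insert_commute)
  have pair: "contraction (edge b c) ?F \<tau> = 0" if \<tau>: "\<tau> \<in> matchings Z" for \<tau>
  proof -
    have "\<tau> \<in> matchings (insert x Z)" "\<tau> \<in> matchings (insert y Z)"
      using \<tau> by (auto intro: matchings_mono)
    then show ?thesis
      using pair_extension_contraction_pair[OF f0, of \<tau>] pair_extension_contraction_pair[OF g0, of \<tau>] Z W
      by (simp add: contraction_diff contraction_scale)
  qed
  have key: "coboundary_on p (Z - {z}) (\<lambda>\<tau>. contraction (edge d z) ?F \<tau> - contraction (edge b c) ?F \<tau>)"
    if z: "z \<in> Z" and d: "d = b \<or> d = c" for d z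
  proof -
    define Q where "Q = Z - {z}"
    have Q: "Z = insert z Q" "z \<notin> Q" "finite Q" "card Q = 3 * p" "b \<notin> Q" "c \<notin> Q" "x \<notin> Q" "y \<notin> Q"
      "z \<noteq> b" "z \<noteq> c" "z \<noteq> x" "z \<noteq> y"
      using z Z by (auto simp: Q_def)
    have f1: "pair_extension p \<phi> (insert b (insert c (insert z (insert x Q)))) b c f"
      and g1: "pair_extension p \<phi> (insert b (insert c (insert z (insert y Q)))) b c g"
      using f0 g0 unfolding Q(1) by (simp_all add: insert_commute)
    define s :: 'r where "s = (if d = b then 1 else -1)"
    define \<alpha> :: 'r where "\<alpha> = order_sign x W * s *
      (order_sign b (insert c (insert z (insert x Q))) * order_sign c (insert z (insert x Q)) * order_sign z (insert x Q))"
    define \<beta> :: 'r where "\<beta> = order_sign y W * s *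
      (order_sign b (insert c (insert z (insert y Q))) * order_sign c (insert z (insert y Q)) * order_sign z (insert y Q))"
    have "\<alpha> * order_sign x Q = \<beta> * order_sign y Q"
      unfolding \<alpha>_def \<beta>_def Z(1) Q(1)
      using Q Z W(7) swap_sign_antisym[OF Z(8), where 'r = 'r] swap_sign_antisym[OF Z(9), where 'r = 'r]
        swap_sign_antisym[OF Z(10), where 'r = 'r] swap_sign_antisym[OF Z(11), where 'r = 'r]
        swap_sign_antisym[OF Q(11), where 'r = 'r] swap_sign_antisym[OF Q(12), where 'r = 'r]
      by (simp add: order_sign_insert mult_ac)
    then have "coboundary_on p Q (\<lambda>\<tau>. \<alpha> * \<phi> (insert x Q) \<tau> - \<beta> * \<phi> (insert y Q) \<tau>)"
      by (intro bottom_family_compare[OF \<phi>]) (use Q in auto)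
    then show ?thesis
      unfolding Q_def[symmetric]
    proof (rule coboundary_on_cong)
      fix \<tau> assume \<tau>: "\<tau> \<in> matchings Q"
      then have m: "\<tau> \<in> matchings (insert x Q)" "\<tau> \<in> matchings (insert y Q)" "\<tau> \<in> matchings Z"
        unfolding Q(1) by (auto intro: matchings_mono)
      have "contraction (edge d z) f \<tau> = s * (order_sign b (insert c (insert z (insert x Q))) *
          order_sign c (insert z (insert x Q)) * order_sign z (insert x Q) * \<phi> (insert x Q) \<tau>)"
        using d pair_extension_contractions[OF f1 _ _ _ m(1)] Q(2,5-12) Z(8-11) W(7) by (auto simp: s_def)
      moreover have "contraction (edge d z) g \<tau> = s * (order_sign b (insert c (insert z (insert y Q))) *
          order_sign c (insert z (insert y Q)) * order_sign z (insert y Q) * \<phi> (insert y Q) \<tau>)"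
        using d pair_extension_contractions[OF g1 _ _ _ m(2)] Q(2,5-12) Z(8-11) W(7) by (auto simp: s_def)
      ultimately show "contraction (edge d z) ?F \<tau> - contraction (edge b c) ?F \<tau> =
          \<alpha> * \<phi> (insert x Q) \<tau> - \<beta> * \<phi> (insert y Q) \<tau>"
        unfolding pair[OF m(3)] by (simp add: contraction_diff contraction_scale \<alpha>_def \<beta>_def mult.assoc)
    qed
  qed
  have "coboundary_on (Suc p) (insert b (insert c Z)) ?F"
    by (rule coboundary_on_pair[OF _ _ _ _ _ _ key key]) (use Z W(7) F in auto)
  then show ?thesis by (simp flip: Z(1))
qed

lemma coboundary_on_trans:
  assumes "coboundary_on p V (\<lambda>\<sigma>. f \<sigma> - h \<sigma>)" "coboundary_on p V (\<lambda>\<sigma>. h \<sigma> - g \<sigma>)"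
  shows "coboundary_on p V (\<lambda>\<sigma>. f \<sigma> - g \<sigma>)"
  using coboundary_on_add[OF assms] by simp

text \<open>
  The special case \<open>x = y\<close> of the comparison, which suffices since a class on \<open>3 p + 4\<close> vertices is
  determined by its restriction to \<open>3 p + 3\<close> of them.
\<close>
lemma pair_extension_same_pair:
  fixes \<phi> :: "'v::linorder set \<Rightarrow> ('v \<times> 'v) set \<Rightarrow> 'r::comm_ring_1"
  assumes \<phi>: "bottom_family p \<phi>" and V: "finite V" "card V = 3 * Suc p + 1"
    and f: "pair_extension p \<phi> V b c f" and g: "pair_extension p \<phi> V b c g"
  shows "coboundary_on (Suc p) V (\<lambda>\<sigma>. f \<sigma> - g \<sigma>)"
proof -
  have bc: "b \<in> V" "c \<in> V" "b \<noteq> c" using f by (auto simp: pair_extension_def)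
  have "card (V - {b, c}) \<noteq> 0" using bc V by (simp add: card_Diff_subset)
  then have "V - {b, c} \<noteq> {}" by (metis card.empty)
  then obtain x where x: "x \<in> V - {b, c}" by blast
  define W where "W = V - {x}"
  have W: "V = insert x W" "x \<notin> W" "finite W" "card W = 3 * Suc p" "b \<in> W" "c \<in> W"
    using x V bc by (auto simp: W_def)
  have "coboundary_on (Suc p) W (\<lambda>\<sigma>. order_sign x W * (order_sign x W * f \<sigma> - order_sign x W * g \<sigma>))"
    by (intro coboundary_on_scale pair_extension_restrict_compare[OF \<phi> W(3,4,2,2,5,6) bc(3)])
      (use f g W in auto)
  then have "coboundary_on (Suc p) W (\<lambda>\<sigma>. f \<sigma> - g \<sigma>)"
    by (simp add: right_diff_distrib)
  moreover have "cocycle_on (Suc p) V (\<lambda>\<sigma>. f \<sigma> - g \<sigma>)"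
    by (intro cocycle_on_diff pair_extension_cocycle[OF f] pair_extension_cocycle[OF g])
  ultimately show ?thesis
    unfolding W(1) by (intro coboundary_on_insert) (use W in auto)
qed

lemma pair_extension_same_second:
  fixes \<phi> :: "'v::linorder set \<Rightarrow> ('v \<times> 'v) set \<Rightarrow> 'r::comm_ring_1"
  assumes three: "(3 :: 'r) = 0" and \<phi>: "bottom_family p \<phi>" and V: "finite V" "card V = 3 * Suc p + 1"
    and f: "pair_extension p \<phi> V b c f" and g: "pair_extension p \<phi> V d c g"
  shows "coboundary_on (Suc p) V (\<lambda>\<sigma>. f \<sigma> - g \<sigma>)"
proof (cases "b = d")
  case True
  then show ?thesis using pair_extension_same_pair[OF \<phi> V f] g by simp
next
  case False
  define Y where "Y = V - {b, c, d}"
  have m: "b \<in> V" "c \<in> V" "d \<in> V" "b \<noteq> c" "d \<noteq> c" using f g by (auto simp: pair_extension_def)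
  then have Y: "V = insert b (insert c (insert d Y))" by (auto simp: Y_def)
  have Y': "finite Y" "card Y = 3 * p + 1" "b \<notin> Y" "c \<notin> Y" "d \<notin> Y"
    using V m False by (auto simp: Y_def card_Diff_subset)
  show ?thesis
    using pair_extension_change_vertex[OF three \<phi> Y' _ False] f g m unfolding Y by simp
qed

text \<open>
  Any pair \<open>b\<close>, \<open>c\<close> is transformed into any other by exchanging one vertex at a time and swapping.
\<close>
lemma pair_extension_unique:
  fixes \<phi> :: "'v::linorder set \<Rightarrow> ('v \<times> 'v) set \<Rightarrow> 'r::comm_ring_1"
  assumes three: "(3 :: 'r) = 0" and \<phi>: "bottom_family p \<phi>" and V: "finite V" "card V = 3 * Suc p + 1"
    and f: "pair_extension p \<phi> V b c f" and g: "pair_extension p \<phi> V b' c' g"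
  shows "coboundary_on (Suc p) V (\<lambda>\<sigma>. f \<sigma> - g \<sigma>)"
proof (cases "b' = c")
  case True
  show ?thesis
    using pair_extension_same_second[OF three \<phi> V f] pair_extension_commute[OF g V(1)] True by simp
next
  case False
  have m: "b' \<in> V" "c \<in> V" using f g by (auto simp: pair_extension_def)
  obtain h where h: "pair_extension p \<phi> V b' c h"
    using pair_extension_exists[OF \<phi> V m False] by blast
  show ?thesis
    using pair_extension_same_second[OF three \<phi> V f h]
      pair_extension_same_second[OF three \<phi> V pair_extension_commute[OF h V(1)] pair_extension_commute[OF g V(1)]]
    by (rule coboundary_on_trans)
qed

definition detects_joins :: "nat \<Rightarrow> ('v::linorder set \<Rightarrow> ('v \<times> 'v) set \<Rightarrow> 'r::comm_ring_1) \<Rightarrow> bool" where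
  "detects_joins p \<phi> \<longleftrightarrow> (\<forall>ts x. distinct (x # triple_vertices ts) \<longrightarrow> length ts = p \<longrightarrow>
     join_eval (map fork ts) (\<phi> (insert x (set (triple_vertices ts)))) \<in> {1, -1})"

lemma join_eval_cohomologous:
  assumes "distinct (triple_vertices ts)" "length ts = p" "set (triple_vertices ts) \<subseteq> V"
    and "coboundary_on p V (\<lambda>\<sigma>. f \<sigma> - g \<sigma>)"
  shows "join_eval (map fork ts) f = join_eval (map fork ts) g"
  using join_eval_coboundary_on[OF assms] by (simp add: join_eval_diff)

lemma order_sign_cases: "order_sign x A = (1 :: 'r::comm_ring_1) \<or> order_sign x A = (-1 :: 'r)"
  unfolding order_sign_def by (metis neg_one_even_power neg_one_odd_power)

lemma swap_sign_cases: "swap_sign x a = (1 :: 'r::comm_ring_1) \<or> swap_sign x a = (-1 :: 'r)"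
  by (simp add: swap_sign_def)

text \<open>
  Choosing the pair \<open>a\<close>, \<open>x\<close>, where \<open>x\<close> is the vertex outside all triples, gives direct access to
  the contractions along \<open>a b\<close> and \<open>a c\<close>. They take opposite values on the join of the remaining
  triples, because exchanging \<open>b\<close> and \<open>c\<close> reverses the orientation. The difference is thus twice one
  of them.
\<close>
lemma pair_extension_join_eval:
  fixes \<phi> :: "'v::linorder set \<Rightarrow> ('v \<times> 'v) set \<Rightarrow> 'r::comm_ring_1"
  assumes three: "(3 :: 'r) = 0" and \<phi>: "bottom_family p \<phi>" "detects_joins p \<phi>"
    and ts: "distinct (x # triple_vertices ((a, b, c) # ts))" "length ts = p"
    and f: "pair_extension p \<phi> (insert x (set (triple_vertices ((a, b, c) # ts)))) a x f"
  shows "join_eval (map fork ((a, b, c) # ts)) f \<in> {1, -1}"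
proof -
  define T where "T = set (triple_vertices ts)"
  let ?J = "join_eval (map fork ts) :: (('v \<times> 'v) set \<Rightarrow> 'r) \<Rightarrow> 'r"
  have T: "finite T" "card T = 3 * p" "a \<notin> T" "b \<notin> T" "c \<notin> T" "x \<notin> T"
    "a \<noteq> b" "a \<noteq> c" "b \<noteq> c" "x \<noteq> a" "x \<noteq> b" "x \<noteq> c"
    using ts distinct_card[of "triple_vertices ts"] by (auto simp: T_def length_triple_vertices)
  have dist: "distinct (triple_vertices ts)" using ts by simp
  define \<epsilon> :: 'r where "\<epsilon> = order_sign a (insert x (insert b (insert c T))) * order_sign x (insert b (insert c T))"
  have fb: "pair_extension p \<phi> (insert a (insert x (insert b (insert c T)))) a x f"
    and fc: "pair_extension p \<phi> (insert a (insert x (insert c (insert b T)))) a x f"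
    using f by (simp_all add: T_def insert_commute)
  have mT: "\<tau> \<in> matchings (insert v T)" if "\<tau> \<in> choices (map fork ts)" for \<tau> v
    using choices_fork_matching[OF dist that] matchings_mono[of \<tau> T "insert v T"] by (auto simp: T_def)
  have eb: "?J (contraction (edge a b) f) = ?J (\<lambda>\<tau>. \<epsilon> * order_sign b (insert c T) * \<phi> (insert c T) \<tau>)"
    by (intro join_eval_cong)
      (use pair_extension_contractions(1)[OF fb _ _ _ mT] T in \<open>simp add: \<epsilon>_def\<close>)
  have ec: "?J (contraction (edge a c) f) = ?J (\<lambda>\<tau>. \<epsilon> * order_sign c (insert b T) * \<phi> (insert b T) \<tau>)"
    by (intro join_eval_cong)
      (use pair_extension_contractions(1)[OF fc _ _ _ mT] T in \<open>simp add: \<epsilon>_def insert_commute\<close>)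
  define E where "E = order_sign b T * ?J (\<phi> (insert b T))"
  have "coboundary_on p T (\<lambda>\<sigma>. order_sign c T * \<phi> (insert c T) \<sigma> - order_sign b T * \<phi> (insert b T) \<sigma>)"
    using T by (intro bottom_family_compare[OF \<phi>(1)]) auto
  from join_eval_cohomologous[OF dist ts(2) _ this]
  have E': "order_sign c T * ?J (\<phi> (insert c T)) = E"
    by (simp add: E_def join_eval_scale T_def)
  have "join_eval (map fork ((a, b, c) # ts)) f =
      \<epsilon> * swap_sign b c * order_sign b T * order_sign c T * (2 * E)"
  proof -
    have "?J (\<phi> (insert c T)) = order_sign c T * E" "?J (\<phi> (insert b T)) = order_sign b T * E"
      unfolding E'[symmetric] by (simp, simp add: E' E_def)
    then show ?thesis
      using T swap_sign_antisym[OF T(9), where 'r = 'r]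
      by (simp add: eb[unfolded join_eval_scale] ec[unfolded join_eval_scale] order_sign_insert algebra_simps)
  qed
  also have "2 * E = - E"
  proof -
    have "2 * E + E = 3 * E" by simp
    then show ?thesis using three by (simp add: eq_neg_iff_add_eq_0)
  qed
  finally have eval: "join_eval (map fork ((a, b, c) # ts)) f =
    \<epsilon> * swap_sign b c * order_sign b T * order_sign c T * (- E)" .
  have "?J (\<phi> (insert b T)) \<in> {1, -1}"
    using \<phi>(2) ts T unfolding detects_joins_def T_def by (auto simp: T_def)
  then show ?thesis
    unfolding eval \<epsilon>_def E_def
    using order_sign_cases[of b T, where 'r = 'r] order_sign_cases[of c T, where 'r = 'r]
      swap_sign_cases[of b c, where 'r = 'r]
      order_sign_cases[of a "insert x (insert b (insert c T))", where 'r = 'r]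
      order_sign_cases[of x "insert b (insert c T)", where 'r = 'r]
    by (elim disjE insertE emptyE) simp_all
qed

theorem bottom_family_exists:
  assumes three: "(3 :: 'r::comm_ring_1) = 0"
  shows "\<exists>\<phi> :: 'v::linorder set \<Rightarrow> ('v \<times> 'v) set \<Rightarrow> 'r. bottom_family p \<phi> \<and> detects_joins p \<phi>"
proof (induction p)
  case 0
  have "cocycle_on 0 V (\<lambda>_. 1 :: 'r)" if V: "card V = 1" for V :: "'v set"
  proof -
    have empty: "\<sigma> = {}" if \<sigma>: "\<sigma> \<in> matchings V" for \<sigma>
    proof (rule equals0I)
      fix e assume "e \<in> \<sigma>"
      then have "fst e < snd e \<and> fst e \<in> V \<and> snd e \<in> V" using \<sigma> unfolding matchings_def by blast
      moreover obtain v where "V = {v}" by (rule card_1_singletonE[OF V])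
      ultimately show False by auto
    qed
    show ?thesis using empty unfolding cocycle_on_def by fastforce
  qed
  then have "bottom_family 0 (\<lambda>(_ :: 'v set) _. 1 :: 'r)"
    by (auto simp: bottom_family_def coboundary_on_0)
  moreover have "detects_joins 0 (\<lambda>(_ :: 'v set) _. 1 :: 'r)" by (simp add: detects_joins_def)
  ultimately show ?case by blast
next
  case (Suc p)
  then obtain \<phi> :: "'v set \<Rightarrow> ('v \<times> 'v) set \<Rightarrow> 'r" where \<phi>: "bottom_family p \<phi>" "detects_joins p \<phi>"
    by blast
  have "\<exists>f b c. pair_extension p \<phi> V b c f" if V: "finite V" "card V = 3 * Suc p + 1" for V
  proof -
    have "\<not> card V \<le> Suc 0" using V(2) by simp
    then obtain b c where "b \<in> V" "c \<in> V" "b \<noteq> c"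
      unfolding card_le_Suc0_iff_eq[OF V(1)] by blast
    then show ?thesis using pair_extension_exists[OF \<phi>(1) V] by blast
  qed
  then obtain \<Phi> where \<Phi>: "\<And>V. finite V \<Longrightarrow> card V = 3 * Suc p + 1 \<Longrightarrow> \<exists>b c. pair_extension p \<phi> V b c (\<Phi> V)"
    by metis
  have close: "coboundary_on (Suc p) V (\<lambda>\<sigma>. \<Phi> V \<sigma> - f \<sigma>)"
    if V: "finite V" "card V = 3 * Suc p + 1" and f: "pair_extension p \<phi> V b c f" for V b c f
    using \<Phi>[OF V] pair_extension_unique[OF three \<phi>(1) V _ f] by blast
  have "bottom_family (Suc p) \<Phi>"
    unfolding bottom_family_def
  proof (intro conjI allI impI)
    fix V :: "'v set" assume "finite V" "card V = 3 * Suc p + 1"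
    then show "cocycle_on (Suc p) V (\<Phi> V)" using \<Phi> pair_extension_cocycle by blast
  next
    fix W :: "'v set" and x y assume W: "finite W" "card W = 3 * Suc p" "x \<notin> W" "y \<notin> W"
    have "\<not> card W \<le> Suc 0" using W(2) by simp
    then obtain b c where bc: "b \<in> W" "c \<in> W" "b \<noteq> c"
      unfolding card_le_Suc0_iff_eq[OF W(1)] by blast
    have V: "finite (insert z W)" "card (insert z W) = 3 * Suc p + 1" if "z \<notin> W" for z
      using W that by auto
    obtain f g where f: "pair_extension p \<phi> (insert x W) b c f" and g: "pair_extension p \<phi> (insert y W) b c g"
      using pair_extension_exists[OF \<phi>(1) V[OF W(3)], of b c] pair_extension_exists[OF \<phi>(1) V[OF W(4)], of b c] bc
      by (metis insertI2)
    have 1: "coboundary_on (Suc p) W (\<lambda>\<sigma>. order_sign x W * (\<Phi> (insert x W) \<sigma> - f \<sigma>))"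
      by (rule coboundary_on_scale, rule coboundary_on_mono[OF close[OF V[OF W(3)] f]]) auto
    have 2: "coboundary_on (Suc p) W (\<lambda>\<sigma>. (- order_sign y W) * (\<Phi> (insert y W) \<sigma> - g \<sigma>))"
      by (rule coboundary_on_scale, rule coboundary_on_mono[OF close[OF V[OF W(4)] g]]) auto
    have 3: "coboundary_on (Suc p) W (\<lambda>\<sigma>. order_sign x W * f \<sigma> - order_sign y W * g \<sigma>)"
      by (rule pair_extension_restrict_compare[OF \<phi>(1) W bc f g])
    show "coboundary_on (Suc p) W
        (\<lambda>\<sigma>. order_sign x W * \<Phi> (insert x W) \<sigma> - order_sign y W * \<Phi> (insert y W) \<sigma>)"
      by (rule coboundary_on_cong[OF coboundary_on_add[OF coboundary_on_add[OF 1 2] 3]])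
        (simp add: algebra_simps)
  qed
  moreover have "detects_joins (Suc p) \<Phi>"
    unfolding detects_joins_def
  proof (intro allI impI)
    fix x :: 'v and ts assume ts: "distinct (x # triple_vertices ts)" "length ts = Suc p"
    obtain a b c us where us: "ts = (a, b, c) # us" "length us = p"
      using ts(2) by (cases ts) auto
    let ?V = "insert x (set (triple_vertices ts))"
    have V: "finite ?V" "card ?V = 3 * Suc p + 1"
      using ts distinct_card[of "triple_vertices ts"] by (auto simp: length_triple_vertices)
    obtain f where f: "pair_extension p \<phi> ?V a x f"
      using pair_extension_exists[OF \<phi>(1) V, of a x] ts(1) us(1) by auto
    have "join_eval (map fork ts) (\<Phi> ?V) = join_eval (map fork ts) f"
      by (rule join_eval_cohomologous[OF _ ts(2) _ close[OF V f]]) (use ts in auto)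
    then show "join_eval (map fork ts) (\<Phi> ?V) \<in> {1, - 1}"
      using pair_extension_join_eval[OF three \<phi>, of x a b c us f] ts f us by simp
  qed
  ultimately show ?case by blast
qed

section \<open>Homology classes detected by cochains\<close>

text \<open>
  Integral chains are evaluated against cochains with values in any commutative ring. Integer
  cochains test whether a chain is a cycle, cochains modulo 3 whether it is a boundary.
\<close>
definition pairing :: "('a set \<Rightarrow> 'r::comm_ring_1) \<Rightarrow> ('a set \<Rightarrow>\<^sub>0 int) \<Rightarrow> 'r" where
  "pairing f z = (\<Sum>\<sigma>\<in>Poly_Mapping.keys z. of_int (poly_mapping.lookup z \<sigma>) * f \<sigma>)"

lemma pairing_superset:
  assumes "finite S" "Poly_Mapping.keys z \<subseteq> S"
  shows "pairing f z = (\<Sum>\<sigma>\<in>S. of_int (poly_mapping.lookup z \<sigma>) * f \<sigma>)"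
  unfolding pairing_def using assms
  by (intro sum.mono_neutral_left) (auto simp: in_keys_iff)

lemma pairing_zero [simp]: "pairing f 0 = 0"
  by (simp add: pairing_def)

lemma pairing_of [simp]: "pairing f (frag_of \<sigma>) = f \<sigma>"
  by (simp add: pairing_def)

lemma pairing_add: "pairing f (y + z) = pairing f y + pairing f z"
proof -
  let ?S = "Poly_Mapping.keys y \<union> Poly_Mapping.keys z"
  have "finite ?S" by simp
  then show ?thesis
    using keys_add[of y z]
    by (simp add: pairing_superset[of ?S] lookup_add distrib_right sum.distrib)
qed

lemma pairing_cmul: "pairing f (frag_cmul c z) = of_int c * pairing f z"
proof -
  have "pairing f (frag_cmul c z) =
      (\<Sum>\<sigma>\<in>Poly_Mapping.keys z. of_int (poly_mapping.lookup (frag_cmul c z) \<sigma>) * f \<sigma>)"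
    by (rule pairing_superset) (auto simp: keys_cmul)
  then show ?thesis by (simp add: pairing_def sum_distrib_left mult.assoc)
qed

lemma pairing_uminus: "pairing f (- z) = - pairing f z"
  using pairing_cmul[of f "-1" z] by simp

lemma pairing_diff: "pairing f (y - z) = pairing f y - pairing f z"
  using pairing_add[of f y "- z"] by (simp add: pairing_uminus)

lemma pairing_sum: "pairing f (sum g I) = (\<Sum>i\<in>I. pairing f (g i))"
  by (induction I rule: infinite_finite_induct) (simp_all add: pairing_add)

lemma pairing_frag_extend:
  "pairing f (frag_extend b z) = pairing (\<lambda>\<sigma>. pairing f (b \<sigma>)) z"
proof -
  have "Poly_Mapping.keys z \<subseteq> UNIV" by simp
  then show ?thesis
    by (rule frag_induction) (simp_all add: frag_extend_diff pairing_diff)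
qed

lemma of_int_order_sign [simp]: "of_int (order_sign x A) = order_sign x A"
  by (simp add: order_sign_def)

lemma pairing_simplicial_boundary: "pairing f (simplicial_boundary z) = pairing (coboundary f) z"
proof -
  have "pairing f (face_boundary \<sigma>) = coboundary f \<sigma>" for \<sigma>
    by (simp add: face_boundary_def coboundary_def pairing_sum pairing_cmul order_sign_def)
  then show ?thesis by (simp add: simplicial_boundary_def pairing_frag_extend)
qed

text \<open>
  The chain-level adjoint of contraction along \<open>e\<close>.
\<close>
definition cone_chain :: "'a::linorder \<Rightarrow> ('a set \<Rightarrow>\<^sub>0 int) \<Rightarrow> 'a set \<Rightarrow>\<^sub>0 int" where
  "cone_chain e = frag_extend (\<lambda>\<sigma>. frag_cmul (order_sign e \<sigma>) (frag_of (insert e \<sigma>)))"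

lemma pairing_cone_chain: "pairing f (cone_chain e z) = pairing (contraction e f) z"
  by (simp add: cone_chain_def pairing_frag_extend pairing_cmul contraction_def[abs_def])

lemma keys_cone_chain: "Poly_Mapping.keys (cone_chain e z) \<subseteq> insert e ` Poly_Mapping.keys z"
  unfolding cone_chain_def by (rule order_trans[OF keys_frag_extend]) (auto simp: keys_cmul split: if_splits)

fun join_chain :: "('e::linorder \<times> 'e) list \<Rightarrow> 'e set \<Rightarrow>\<^sub>0 int" where
  "join_chain [] = frag_of {}"
| "join_chain ((d, e) # R) = cone_chain d (join_chain R) - cone_chain e (join_chain R)"

lemma pairing_join_chain: "pairing f (join_chain R) = join_eval R f"
  by (induction R arbitrary: f rule: join_chain.induct) (simp_all add: pairing_diff pairing_cone_chain)

lemma keys_join_chain: "Poly_Mapping.keys (join_chain R) \<subseteq> choices R"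
proof (induction R rule: join_chain.induct)
  case (2 d e R)
  have "Poly_Mapping.keys (cone_chain x (join_chain R)) \<subseteq> insert x ` choices R" for x
    using keys_cone_chain image_mono[OF "2.IH"(1)] by (rule order_trans)
  then show ?case unfolding join_chain.simps choices.simps
    by (intro order_trans[OF keys_diff] Un_mono)
qed simp

text \<open>
  A chain is a cycle if it pairs to zero with all integral coboundaries, as the indicator functions
  of faces separate the coefficients of its boundary. A cycle with a nonzero value under a cocycle
  is not a boundary.
\<close>
lemma nontrivial_reduced_homology_group:
  fixes z :: "'a::linorder set \<Rightarrow>\<^sub>0 int" and f :: "'a set \<Rightarrow> 'r::comm_ring_1"
  assumes K: "simplicial_complex K" and z: "Poly_Mapping.keys z \<subseteq> faces k K"
    and cycle: "\<And>h :: 'a set \<Rightarrow> int. pairing (coboundary h) z = 0"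
    and f: "\<And>\<sigma>. \<sigma> \<in> faces (k + 1) K \<Longrightarrow> coboundary f \<sigma> = 0" and fz: "pairing f z \<noteq> 0"
  shows "\<not> trivial_group (reduced_homology_group k K)"
proof
  let ?C = "simplicial_chain_group k K" and ?B = "boundaries k K"
  assume triv: "trivial_group (reduced_homology_group k K)"
  have "simplicial_boundary z = 0"
  proof (rule poly_mapping_eqI)
    fix \<sigma> :: "'a set"
    let ?h = "\<lambda>\<tau>. if \<tau> = \<sigma> then 1 else 0 :: int"
    have "pairing ?h (simplicial_boundary z) = poly_mapping.lookup (simplicial_boundary z) \<sigma>"
      by (simp add: pairing_def in_keys_iff if_distrib[of "\<lambda>x. _ * x"] sum.delta cong: if_cong)
    then show "poly_mapping.lookup (simplicial_boundary z) \<sigma> = poly_mapping.lookup 0 \<sigma>"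
      using cycle[of ?h] by (simp add: pairing_simplicial_boundary)
  qed
  then have zc: "z \<in> cycles k K"
    using z by (simp add: cycles_def kernel_def simplicial_chain_group_def)
  have zero: "0 \<in> ?B"
    unfolding boundaries_def by (rule image_eqI[of _ _ 0]) (simp_all add: simplicial_chain_group_def)
  have coset: "r_coset (?C\<lparr>carrier := cycles k K\<rparr>) ?B z \<in> carrier (reduced_homology_group k K)"
    using zc by (auto simp: reduced_homology_group_def FactGroup_def RCOSETS_def)
  have "\<one>\<^bsub>reduced_homology_group k K\<^esub> = ?B"
    by (simp add: reduced_homology_group_def FactGroup_def)
  then have "r_coset (?C\<lparr>carrier := cycles k K\<rparr>) ?B z = ?B"
    using coset triv by (auto simp: trivial_group_def)
  moreover have "z \<in> r_coset (?C\<lparr>carrier := cycles k K\<rparr>) ?B z"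
    using zero by (auto simp: r_coset_def simplicial_chain_group_def)
  ultimately have "z \<in> ?B" by simp
  then obtain y where y: "Poly_Mapping.keys y \<subseteq> faces (k + 1) K" "z = simplicial_boundary y"
    by (auto simp: boundaries_def simplicial_chain_group_def)
  have "pairing f z = pairing (coboundary f) y"
    by (simp add: y(2) pairing_simplicial_boundary)
  also have "\<dots> = 0"
    unfolding pairing_def using y(1) f by (intro sum.neutral) auto
  finally show False using fz by simp
qed

section \<open>Rook placements as matchings\<close>

text \<open>
  The map is increasing for the lexicographic order of cells and of edges, so all signs are
  preserved when cochains are pulled back along it.
\<close>
definition cell_edge :: "nat \<Rightarrow> nat \<times> nat \<Rightarrow> nat \<times> nat" where
  "cell_edge n = (\<lambda>(i, j). (i, n + j))"

lemma cell_edge_simp [simp]: "cell_edge n (i, j) = (i, n + j)"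
  by (simp add: cell_edge_def)

lemma strict_mono_cell_edge: "strict_mono (cell_edge n)"
  by (auto simp: strict_mono_def cell_edge_def less_prod_def)

lemma card_strict_mono_image:
  fixes g :: "'a::linorder \<Rightarrow> 'b::order"
  shows "strict_mono g \<Longrightarrow> card (g ` A) = card A"
  by (intro card_image strict_mono_imp_inj_on)

lemma order_sign_image:
  fixes g :: "'a::linorder \<Rightarrow> 'b::linorder"
  assumes "strict_mono g"
  shows "order_sign (g x) (g ` A) = order_sign x A"
proof -
  have "{a \<in> g ` A. a < g x} = g ` {a \<in> A. a < x}"
    using strict_mono_less[OF assms] by auto
  then show ?thesis
    by (simp add: order_sign_def card_strict_mono_image[OF assms])
qed

lemma contraction_image:
  "strict_mono g \<Longrightarrow> contraction e (\<lambda>\<sigma>. f (g ` \<sigma>)) = (\<lambda>\<sigma>. contraction (g e) f (g ` \<sigma>))"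
  by (simp add: contraction_def fun_eq_iff order_sign_image)

lemma coboundary_image:
  fixes g :: "'a::linorder \<Rightarrow> 'b::linorder"
  assumes "strict_mono g"
  shows "coboundary (\<lambda>\<sigma>. f (g ` \<sigma>)) \<sigma> = coboundary f (g ` \<sigma>)"
proof -
  have inj: "inj g" using assms by (rule strict_mono_imp_inj_on)
  then have "inj_on g \<sigma>" by (rule inj_on_subset) simp
  moreover have "g ` (\<sigma> - {v}) = g ` \<sigma> - {g v}" for v
    using inj by (simp add: image_set_diff)
  ultimately show ?thesis
    by (simp add: coboundary_def sum.reindex order_sign_image[OF assms])
qed

lemma join_eval_image:
  "strict_mono g \<Longrightarrow> join_eval R (\<lambda>\<sigma>. f (g ` \<sigma>)) = join_eval (map (map_prod g g) R) f"
  by (induction R arbitrary: f rule: choices.induct) (simp_all add: contraction_image)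

lemma choices_image: "choices (map (map_prod g g) R) = (`) g ` choices R"
  by (induction R rule: choices.induct) (auto simp: image_Un image_image)

lemma separated_image: "separated (map (map_prod g g) R) \<Longrightarrow> separated R"
  by (induction R rule: separated.induct) (auto simp: choices_image)

lemma rook_complex_matching:
  assumes "\<sigma> \<in> rook_complex (off_diagonal_board n)"
  shows "cell_edge n ` \<sigma> \<in> matchings {1..2 * n}"
proof -
  have \<sigma>: "finite \<sigma>" "\<sigma> \<subseteq> {1..n} \<times> {1..n}"
    "\<And>p q. p \<in> \<sigma> \<Longrightarrow> q \<in> \<sigma> \<Longrightarrow> p \<noteq> q \<Longrightarrow> fst p \<noteq> fst q \<and> snd p \<noteq> snd q"
    using assms unfolding rook_complex_def off_diagonal_board_def by blast+
  have range: "1 \<le> fst p \<and> fst p \<le> n \<and> 1 \<le> snd p \<and> snd p \<le> n" if "p \<in> \<sigma>" for p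
    using \<sigma>(2) that by (cases p) auto
  show ?thesis
    unfolding matchings_def mem_Collect_eq
  proof (intro conjI ballI impI)
    fix d e assume d: "d \<in> cell_edge n ` \<sigma>" and e: "e \<in> cell_edge n ` \<sigma>" and ne: "d \<noteq> e"
    obtain p q where p: "p \<in> \<sigma>" "d = cell_edge n p" and q: "q \<in> \<sigma>" "e = cell_edge n q" using d e by blast
    then have "fst p \<noteq> fst q \<and> snd p \<noteq> snd q" using \<sigma>(3)[of p q] ne by blast
    then show "{fst d, snd d} \<inter> {fst e, snd e} = {}"
      using range[OF p(1)] range[OF q(1)] p(2) q(2) by (cases p; cases q) auto
  next
    fix e assume "e \<in> cell_edge n ` \<sigma>"
    then obtain p where p: "p \<in> \<sigma>" "e = cell_edge n p" by blast
    show "fst e < snd e" "fst e \<in> {1..2 * n}" "snd e \<in> {1..2 * n}"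
      using range[OF p(1)] p(2) by (cases p; auto)+
  qed (use \<sigma>(1) in simp)
qed

lemma matching_rook_complex:
  assumes "cell_edge n ` \<sigma> \<in> matchings V" "\<sigma> \<subseteq> off_diagonal_board n"
  shows "\<sigma> \<in> rook_complex (off_diagonal_board n)"
proof -
  have inj: "inj (cell_edge n)" using strict_mono_cell_edge by (rule strict_mono_imp_inj_on)
  have "finite \<sigma>" using finite_matching[OF assms(1)] inj by (metis finite_imageD inj_on_subset subset_UNIV)
  moreover have "fst p \<noteq> fst q \<and> snd p \<noteq> snd q" if pq: "p \<in> \<sigma>" "q \<in> \<sigma>" "p \<noteq> q" for p q
  proof -
    have "cell_edge n p \<noteq> cell_edge n q" using inj pq(3) by (simp add: inj_eq)
    then have "{fst (cell_edge n p), snd (cell_edge n p)} \<inter> {fst (cell_edge n q), snd (cell_edge n q)} = {}"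
      using assms(1) pq(1,2) unfolding matchings_def by blast
    then show ?thesis by (cases p; cases q) auto
  qed
  ultimately show ?thesis using assms(2) unfolding rook_complex_def by blast
qed

definition pair_cells :: "('e \<times> 'e) list \<Rightarrow> 'e set" where
  "pair_cells R = (\<Union>(d, e)\<in>set R. {d, e})"

lemma pair_cells_simps [simp]: "pair_cells [] = {}" "pair_cells ((d, e) # R) = insert d (insert e (pair_cells R))"
  by (auto simp: pair_cells_def)

lemma choices_subset_cells: "\<sigma> \<in> choices R \<Longrightarrow> \<sigma> \<subseteq> pair_cells R"
  by (induction R arbitrary: \<sigma> rule: choices.induct) fastforce+

lemma choices_rook_complex:
  assumes R: "map (map_prod (cell_edge n) (cell_edge n)) R = map fork ts" "distinct (triple_vertices ts)"
    "pair_cells R \<subseteq> off_diagonal_board n" and \<sigma>: "\<sigma> \<in> choices R"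
  shows "\<sigma> \<in> rook_complex (off_diagonal_board n)" "card \<sigma> = length ts"
proof -
  have "cell_edge n ` \<sigma> \<in> choices (map fork ts)"
    using \<sigma> unfolding R(1)[symmetric] choices_image by blast
  from choices_fork_matching[OF R(2) this]
  have m: "cell_edge n ` \<sigma> \<in> matchings (set (triple_vertices ts))" "card (cell_edge n ` \<sigma>) = length ts" by auto
  show "\<sigma> \<in> rook_complex (off_diagonal_board n)"
    using m(1) choices_subset_cells[OF \<sigma>] R(3) by (intro matching_rook_complex) auto
  show "card \<sigma> = length ts"
    using m(2) by (simp add: card_strict_mono_image[OF strict_mono_cell_edge])
qed

text \<open>
  The classes live on one vertex more than the triples use, hence the additional vertex \<open>x\<close>. The
  type \<open>3\<close> of residues modulo 3 is the ring of coefficients.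
\<close>
lemma detecting_cocycle:
  assumes R: "map (map_prod (cell_edge n) (cell_edge n)) R = map fork ts" "distinct (x # triple_vertices ts)"
  obtains f :: "(nat \<times> nat) set \<Rightarrow> 3" where "join_eval R f \<noteq> 0"
    and "\<And>\<sigma>. cell_edge n ` \<sigma> \<in> matchings (insert x (set (triple_vertices ts))) \<Longrightarrow>
      card \<sigma> = Suc (length ts) \<Longrightarrow> coboundary f \<sigma> = 0"
proof -
  let ?V = "insert x (set (triple_vertices ts))"
  have "(3 :: 3) = 0" by simp
  then obtain \<phi> :: "nat set \<Rightarrow> (nat \<times> nat) set \<Rightarrow> 3"
    where \<phi>: "bottom_family (length ts) \<phi>" "detects_joins (length ts) \<phi>"
    using bottom_family_exists[where 'v = nat and 'r = 3] by blast
  have "card ?V = 3 * length ts + 1"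
    using R(2) distinct_card[of "triple_vertices ts"] by (simp add: length_triple_vertices)
  then have cocycle: "cocycle_on (length ts) ?V (\<phi> ?V)"
    by (intro bottom_family_cocycle[OF \<phi>(1)]) simp_all
  show thesis
  proof (rule that[of "\<lambda>\<sigma>. \<phi> ?V (cell_edge n ` \<sigma>)"])
    have "join_eval (map fork ts) (\<phi> ?V) \<in> {1, -1}"
      using \<phi>(2) R(2) unfolding detects_joins_def by blast
    then show "join_eval R (\<lambda>\<sigma>. \<phi> ?V (cell_edge n ` \<sigma>)) \<noteq> 0"
      unfolding join_eval_image[OF strict_mono_cell_edge] R(1) by auto
  next
    fix \<sigma> assume "cell_edge n ` \<sigma> \<in> matchings ?V" "card \<sigma> = Suc (length ts)"
    then show "coboundary (\<lambda>\<sigma>. \<phi> ?V (cell_edge n ` \<sigma>)) \<sigma> = 0"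
      using cocycle
      by (simp add: coboundary_image[OF strict_mono_cell_edge] cocycle_on_def
          card_strict_mono_image[OF strict_mono_cell_edge])
  qed
qed

lemma join_chain_nontrivial:
  assumes R: "map (map_prod (cell_edge n) (cell_edge n)) R = map fork ts" "distinct (x # triple_vertices ts)"
    "pair_cells R \<subseteq> off_diagonal_board n" "{1..2 * n} \<subseteq> insert x (set (triple_vertices ts))"
  shows "\<not> trivial_group (reduced_homology_group (int (length ts) - 1) (rook_complex (off_diagonal_board n)))"
proof -
  obtain f :: "(nat \<times> nat) set \<Rightarrow> 3" where f: "join_eval R f \<noteq> 0"
    "\<And>\<sigma>. cell_edge n ` \<sigma> \<in> matchings (insert x (set (triple_vertices ts))) \<Longrightarrow>
      card \<sigma> = Suc (length ts) \<Longrightarrow> coboundary f \<sigma> = 0"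
    using detecting_cocycle[OF R(1,2)] by blast
  have dist: "distinct (triple_vertices ts)" using R(2) by simp
  show ?thesis
  proof (rule nontrivial_reduced_homology_group[OF simplicial_complex_rook_complex])
    have "\<sigma> \<in> faces (int (length ts) - 1) (rook_complex (off_diagonal_board n))" if "\<sigma> \<in> choices R" for \<sigma>
      using choices_rook_complex[OF R(1) dist R(3) that] finite_choice[OF that] by (simp add: faces_def)
    then show "Poly_Mapping.keys (join_chain R) \<subseteq> faces (int (length ts) - 1) (rook_complex (off_diagonal_board n))"
      using keys_join_chain[of R] by blast
    show "pairing f (join_chain R) \<noteq> 0" using f(1) by (simp add: pairing_join_chain)
    fix h :: "(nat \<times> nat) set \<Rightarrow> int"
    have "separated R" using separated_fork[OF dist] separated_image unfolding R(1)[symmetric] by blast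
    then show "pairing (coboundary h) (join_chain R) = 0"
      by (simp add: pairing_join_chain join_eval_coboundary)
  next
    fix \<sigma> assume "\<sigma> \<in> faces (int (length ts) - 1 + 1) (rook_complex (off_diagonal_board n))"
    then have "\<sigma> \<in> rook_complex (off_diagonal_board n)" "card \<sigma> = Suc (length ts)"
      by (auto simp: faces_def)
    then show "coboundary f \<sigma> = 0"
      using matchings_mono[OF rook_complex_matching R(4)] by (intro f(2))
  qed
qed

section \<open>Cycles on the off-diagonal board\<close>

text \<open>
  Triples that fill the rows and columns \<open>s + 1\<close>, \<open>s + 2\<close>, \<open>s + 3\<close> and avoid the diagonal: the two
  lower cells of the first column and the two right cells of the first row.
\<close>
fun block_pairs :: "nat \<Rightarrow> nat \<Rightarrow> ((nat \<times> nat) \<times> (nat \<times> nat)) list" where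
  "block_pairs s 0 = []"
| "block_pairs s (Suc k) = ((s + 2, s + 1), (s + 3, s + 1)) # ((s + 1, s + 2), (s + 1, s + 3)) #
     block_pairs (s + 3) k"

text \<open>
  The same triples in terms of vertices. The common end of the two edges, a column or a row, comes
  first.
\<close>
fun block_triples :: "nat \<Rightarrow> nat \<Rightarrow> nat \<Rightarrow> (nat \<times> nat \<times> nat) list" where
  "block_triples n s 0 = []"
| "block_triples n s (Suc k) = (n + (s + 1), s + 2, s + 3) # (s + 1, n + (s + 2), n + (s + 3)) #
     block_triples n (s + 3) k"

lemma block_pairs_fork:
  "s + 3 * k \<le> n \<Longrightarrow>
    map (map_prod (cell_edge n) (cell_edge n)) (block_pairs s k) = map fork (block_triples n s k)"
  by (induction s k rule: block_pairs.induct) (simp_all add: edge_def)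

lemma length_block_triples: "length (block_triples n s k) = 2 * k"
  by (induction n s k rule: block_triples.induct) simp_all

lemma set_block_triples:
  "set (triple_vertices (block_triples n s k)) = {s<..s + 3 * k} \<union> {n + s<..n + s + 3 * k}"
proof (induction n s k rule: block_triples.induct)
  case (2 n s k)
  have "{s<..s + 3 * Suc k} = {s + 1, s + 2, s + 3} \<union> {s + 3<..s + 3 + 3 * k}" for s :: nat by auto
  from this[of s] this[of "n + s"] show ?case by (auto simp: 2 add.assoc)
qed simp

lemma distinct_block_triples: "s + 3 * k \<le> n \<Longrightarrow> distinct (triple_vertices (block_triples n s k))"
  by (induction n s k rule: block_triples.induct) (simp_all add: set_block_triples)

lemma block_pairs_cells:
  "c \<in> pair_cells (block_pairs s k) \<Longrightarrow>
    s < fst c \<and> fst c \<le> s + 3 * k \<and> s < snd c \<and> snd c \<le> s + 3 * k \<and> fst c \<noteq> snd c"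
  by (induction s k rule: block_pairs.induct) auto

lemma off_diagonal_board_iff:
  "c \<in> off_diagonal_board n \<longleftrightarrow> 1 \<le> fst c \<and> fst c \<le> n \<and> 1 \<le> snd c \<and> snd c \<le> n \<and> fst c \<noteq> snd c"
  by (cases c) (auto simp: off_diagonal_board_def)

lemma block_pairs_board:
  "s + 3 * k \<le> n \<Longrightarrow> pair_cells (block_pairs s k) \<subseteq> off_diagonal_board n"
  using block_pairs_cells[of _ s k] by (fastforce simp: off_diagonal_board_iff)

text \<open>
  The blocks along the diagonal use every row and column. The vertex \<open>0\<close> is added because the
  classes live on \<open>3 p + 1\<close> vertices.
\<close>
lemma nontrivial_board_0_mod_3:
  assumes "n = 3 * k"
  shows "\<not> trivial_group (reduced_homology_group (int (2 * k) - 1) (rook_complex (off_diagonal_board n)))"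
proof -
  have "\<not> trivial_group (reduced_homology_group (int (length (block_triples n 0 k)) - 1)
      (rook_complex (off_diagonal_board n)))"
  proof (rule join_chain_nontrivial[where R = "block_pairs 0 k" and x = 0])
    show "distinct (0 # triple_vertices (block_triples n 0 k))"
      using assms distinct_block_triples[of 0 k n] by (simp add: set_block_triples)
    show "{1..2 * n} \<subseteq> insert 0 (set (triple_vertices (block_triples n 0 k)))"
      using assms by (auto simp: set_block_triples)
  qed (use assms block_pairs_fork block_pairs_board in auto)
  then show ?thesis by (simp add: length_block_triples)
qed

text \<open>
  Two rows and two columns beyond the \<open>3 \<times> 3\<close> blocks would have no two off-diagonal cells in a
  common line, so they are combined with one block. In the resulting \<open>5 \<times> 5\<close> board three triples
  avoid the diagonal and leave only its last column unused.
\<close>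
lemma nontrivial_board_2_mod_3:
  assumes n: "n = 5 + 3 * m"
  shows "\<not> trivial_group (reduced_homology_group (int (2 * m) + 2) (rook_complex (off_diagonal_board n)))"
proof -
  let ?ts = "(n + 1, 2, 3) # (n + 2, 1, 4) # (5, n + 3, n + 4) # block_triples n 5 m"
  let ?R = "((2, 1), (3, 1)) # ((1, 2), (4, 2)) # ((5, 3), (5, 4)) # block_pairs 5 m"
  have "\<not> trivial_group (reduced_homology_group (int (length ?ts) - 1) (rook_complex (off_diagonal_board n)))"
  proof (rule join_chain_nontrivial[where R = ?R and x = "n + 5"])
    show "map (map_prod (cell_edge n) (cell_edge n)) ?R = map fork ?ts"
      using n block_pairs_fork[of 5 m n] by (simp add: edge_def)
    show "distinct ((n + 5) # triple_vertices ?ts)"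
      using n distinct_block_triples[of 5 m n] by (simp add: set_block_triples)
    show "{1..2 * n} \<subseteq> insert (n + 5) (set (triple_vertices ?ts))"
    proof
      fix v assume "v \<in> {1..2 * n}"
      then show "v \<in> insert (n + 5) (set (triple_vertices ?ts))"
        unfolding triple_vertices_simps list.set set_block_triples n by simp presburger
    qed
    show "pair_cells ?R \<subseteq> off_diagonal_board n"
      using n block_pairs_board[of 5 m n] by (simp add: off_diagonal_board_iff)
  qed
  then show ?thesis by (simp add: length_block_triples add.commute)
qed

text \<open>
  The product with the generator dual to \<open>e\<close>: the cochain supported on sets containing \<open>e\<close> with
  contraction \<open>f\<close>. By Cartan's formula it is a cocycle if \<open>f\<close> is one on the link of \<open>e\<close>.
\<close>
definition extension :: "'a::linorder \<Rightarrow> ('a set \<Rightarrow> 'r::comm_ring_1) \<Rightarrow> 'a set \<Rightarrow> 'r" where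
  "extension e f \<sigma> = (if e \<in> \<sigma> then order_sign e (\<sigma> - {e}) * f (\<sigma> - {e}) else 0)"

lemma contraction_extension: "e \<notin> \<sigma> \<Longrightarrow> contraction e (extension e f) \<sigma> = f \<sigma>"
  by (simp add: contraction_def extension_def)

lemma coboundary_extension:
  assumes "finite \<sigma>" "e \<in> \<sigma> \<Longrightarrow> coboundary f (\<sigma> - {e}) = 0"
  shows "coboundary (extension e f) \<sigma> = 0"
proof (cases "e \<in> \<sigma>")
  case False
  then show ?thesis by (simp add: coboundary_def extension_def)
next
  case True
  let ?\<tau> = "\<sigma> - {e}"
  have "contraction e (coboundary (extension e f)) ?\<tau> =
      extension e f ?\<tau> - coboundary (contraction e (extension e f)) ?\<tau>"
    using assms(1) by (intro contraction_coboundary) auto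
  also have "extension e f ?\<tau> = 0" by (simp add: extension_def)
  also have "coboundary (contraction e (extension e f)) ?\<tau> = coboundary f ?\<tau>"
    unfolding coboundary_def by (intro sum.cong) (auto simp: contraction_extension)
  finally have "order_sign e ?\<tau> * coboundary (extension e f) \<sigma> = 0"
    using assms(2) True by (simp add: contraction_def insert_absorb)
  then have "order_sign e ?\<tau> * (order_sign e ?\<tau> * coboundary (extension e f) \<sigma>) = 0" by simp
  then show ?thesis by simp
qed

text \<open>
  The boundary of the triangle \<open>c\<close>, \<open>d\<close>, \<open>e\<close>, joined with \<open>R\<close>; the join itself has no boundary.
\<close>
lemma join_eval_contractions_coboundary:
  assumes R: "separated R" and c: "\<forall>\<sigma>\<in>choices R. c \<notin> \<sigma> \<and> d \<notin> \<sigma> \<and> e \<notin> \<sigma>" "c \<noteq> d" "c \<noteq> e" "d \<noteq> e"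
  shows "join_eval R (contraction e (contraction d (contraction c (coboundary h)))) =
    join_eval R (contraction e (contraction d h)) - join_eval R (contraction e (contraction c h))
    + join_eval R (contraction d (contraction c h))"
proof -
  let ?g = "contraction c h"
  have "join_eval R (contraction e (contraction d (contraction c (coboundary h)))) =
      join_eval R (contraction e (contraction d (\<lambda>\<sigma>. h \<sigma> - coboundary ?g \<sigma>)))"
  proof (rule join_eval_cong)
    fix \<sigma> assume "\<sigma> \<in> choices R"
    then have "contraction c (coboundary h) (insert d (insert e \<sigma>)) =
        h (insert d (insert e \<sigma>)) - coboundary ?g (insert d (insert e \<sigma>))"
      using c finite_choice by (intro contraction_coboundary) auto
    then show "contraction e (contraction d (contraction c (coboundary h))) \<sigma> =
        contraction e (contraction d (\<lambda>\<sigma>. h \<sigma> - coboundary ?g \<sigma>)) \<sigma>"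
      unfolding contraction_def[of e] contraction_def[of d] by simp
  qed
  also have "\<dots> = join_eval R (contraction e (contraction d h)) -
      join_eval R (contraction e (contraction d (coboundary ?g)))"
    by (simp add: contraction_diff join_eval_diff)
  also have "join_eval R (contraction e (contraction d (coboundary ?g))) =
      join_eval R (contraction e (\<lambda>\<sigma>. ?g \<sigma> - coboundary (contraction d ?g) \<sigma>))"
  proof (rule join_eval_cong)
    fix \<sigma> assume "\<sigma> \<in> choices R"
    then have "contraction d (coboundary ?g) (insert e \<sigma>) =
        ?g (insert e \<sigma>) - coboundary (contraction d ?g) (insert e \<sigma>)"
      using c finite_choice by (intro contraction_coboundary) auto
    then show "contraction e (contraction d (coboundary ?g)) \<sigma> =
        contraction e (\<lambda>\<sigma>. ?g \<sigma> - coboundary (contraction d ?g) \<sigma>) \<sigma>"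
      unfolding contraction_def[of e] by simp
  qed
  also have "\<dots> = join_eval R (contraction e ?g) - join_eval R (contraction d ?g)"
    using R c by (simp add: contraction_diff join_eval_diff join_eval_contraction_coboundary join_eval_coboundary)
  finally show ?thesis by simp
qed

text \<open>
  Oriented triangles of a 2-sphere with eight vertices in the complex of the off-diagonal \<open>4 \<times> 4\<close>
  board. In the first four, the link of the cell \<open>(4,1)\<close> is the quadrilateral that joins the pairs
  \<open>(1,2)\<close>, \<open>(1,3)\<close> and \<open>(2,4)\<close>, \<open>(3,4)\<close>; the other eight fill this quadrilateral without using
  \<open>(4,1)\<close>.
\<close>
definition sphere_facets :: "(int \<times> (nat \<times> nat) \<times> (nat \<times> nat) \<times> (nat \<times> nat)) list" where
  "sphere_facets =
    [(1, (4,1), (1,2), (2,4)), (-1, (4,1), (1,2), (3,4)), (-1, (4,1), (1,3), (2,4)), (1, (4,1), (1,3), (3,4)),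
     (-1, (1,2), (2,4), (3,1)), (1, (1,3), (2,4), (3,1)), (-1, (1,3), (3,4), (4,2)), (1, (1,3), (3,1), (4,2)),
     (1, (2,3), (3,4), (4,2)), (-1, (2,3), (3,1), (4,2)), (-1, (1,2), (2,3), (3,4)), (1, (1,2), (2,3), (3,1))]"

definition sphere_join :: "((nat \<times> nat) \<times> (nat \<times> nat)) list \<Rightarrow> (nat \<times> nat) set \<Rightarrow>\<^sub>0 int" where
  "sphere_join R = sum_list (map (\<lambda>(s, c, d, e). frag_cmul s (cone_chain c (cone_chain d (cone_chain e (join_chain R))))) sphere_facets)"

lemma pairing_sum_list: "pairing f (sum_list (map g xs)) = sum_list (map (\<lambda>x. pairing f (g x)) xs)"
  by (induction xs) (simp_all add: pairing_add)

lemma pairing_sphere_join: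
  "pairing f (sphere_join R) = sum_list (map (\<lambda>(s, c, d, e).
     of_int s * join_eval R (contraction e (contraction d (contraction c f)))) sphere_facets)"
  unfolding sphere_join_def pairing_sum_list
  by (intro arg_cong[of _ _ sum_list] map_cong)
    (auto simp: pairing_cmul pairing_cone_chain pairing_join_chain)

lemma keys_sphere_join:
  assumes "\<sigma> \<in> Poly_Mapping.keys (sphere_join R)"
  obtains s c d e \<rho> where "(s, c, d, e) \<in> set sphere_facets" "\<rho> \<in> choices R"
    "\<sigma> = insert c (insert d (insert e \<rho>))"
proof -
  have keys_sum: "Poly_Mapping.keys (sum_list (map g xs)) \<subseteq> (\<Union>x\<in>set xs. Poly_Mapping.keys (g x))"
    for g :: "'b \<Rightarrow> (nat \<times> nat) set \<Rightarrow>\<^sub>0 int" and xs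
    by (induction xs) (auto dest: subsetD[OF keys_add])
  obtain s c d e where f: "(s, c, d, e) \<in> set sphere_facets"
    and "\<sigma> \<in> Poly_Mapping.keys (frag_cmul s (cone_chain c (cone_chain d (cone_chain e (join_chain R)))))"
    using assms subsetD[OF keys_sum] unfolding sphere_join_def by fastforce
  then have "\<sigma> \<in> Poly_Mapping.keys (cone_chain c (cone_chain d (cone_chain e (join_chain R))))"
    by (simp add: keys_cmul split: if_splits)
  moreover have sub: "Poly_Mapping.keys (cone_chain x y) \<subseteq> insert x ` S"
    if "Poly_Mapping.keys y \<subseteq> S" for x :: "nat \<times> nat" and y S
    using keys_cone_chain image_mono[OF that] by (rule order_trans)
  note sub[OF sub[OF sub[OF keys_join_chain]], of c d e R]
  ultimately obtain \<rho> where "\<rho> \<in> choices R" "\<sigma> = insert c (insert d (insert e \<rho>))" by blast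
  with f show thesis by (rule that)
qed

lemma sphere_facets_cells:
  assumes "(s, c, d, e) \<in> set sphere_facets" "x \<in> {c, d, e}"
  shows "1 \<le> fst x \<and> fst x \<le> 4 \<and> 1 \<le> snd x \<and> snd x \<le> 4 \<and> fst x \<noteq> snd x"
  using assms by (auto simp: sphere_facets_def)

lemma sphere_facets_rooks:
  assumes "(s, c, d, e) \<in> set sphere_facets"
  shows "fst c \<noteq> fst d \<and> fst c \<noteq> fst e \<and> fst d \<noteq> fst e \<and> snd c \<noteq> snd d \<and> snd c \<noteq> snd e \<and> snd d \<noteq> snd e"
  using assms by (auto simp: sphere_facets_def)

lemma rook_complex_insert:
  assumes "\<sigma> \<in> rook_complex A" "c \<in> A" "\<And>q. q \<in> \<sigma> \<Longrightarrow> fst q \<noteq> fst c \<and> snd q \<noteq> snd c"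
  shows "insert c \<sigma> \<in> rook_complex A \<and> card (insert c \<sigma>) = Suc (card \<sigma>)"
proof -
  have "c \<notin> \<sigma>" using assms(3) by blast
  moreover have "finite \<sigma>" using assms(1) by (simp add: rook_complex_def)
  moreover have "insert c \<sigma> \<in> rook_complex A"
  proof -
    have "fst p \<noteq> fst q \<and> snd p \<noteq> snd q" if "p \<in> insert c \<sigma>" "q \<in> insert c \<sigma>" "p \<noteq> q" for p q
    proof -
      have "fst p \<noteq> fst q \<and> snd p \<noteq> snd q" if "p \<in> \<sigma>" "q \<in> \<sigma>"
        using assms(1) that \<open>p \<noteq> q\<close> unfolding rook_complex_def by blast
      then show ?thesis using that assms(3)[of p] assms(3)[of q] by (metis insertE)
    qed
    then show ?thesis using assms(1,2) unfolding rook_complex_def by blast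
  qed
  ultimately show ?thesis by simp
qed

text \<open>
  Each edge of the sphere lies in two triangles, which induce opposite orientations on it.
\<close>
lemma sphere_join_cycle:
  fixes h :: "(nat \<times> nat) set \<Rightarrow> int"
  assumes R: "separated R" "\<And>\<sigma> q. \<sigma> \<in> choices R \<Longrightarrow> q \<in> \<sigma> \<Longrightarrow> 4 < fst q"
  shows "pairing (coboundary h) (sphere_join R) = 0"
proof -
  define J where "J c d = join_eval R (contraction c (contraction d h))" for c d
  have avoid: "q \<notin> \<sigma>" if "\<sigma> \<in> choices R" "fst q \<le> 4" for \<sigma> q
    using R(2)[OF that(1), of q] that(2) by auto
  have facet: "join_eval R (contraction e (contraction d (contraction c (coboundary h)))) = J e d - J e c + J d c"
    if "(s, c, d, e) \<in> set sphere_facets" for s c d e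
    unfolding J_def using sphere_facets_cells[OF that] sphere_facets_rooks[OF that] avoid
    by (intro join_eval_contractions_coboundary[OF R(1)]) auto
  have "pairing (coboundary h) (sphere_join R) =
      sum_list (map (\<lambda>(s, c, d, e). s * (J e d - J e c + J d c)) sphere_facets)"
    unfolding pairing_sphere_join
    by (intro arg_cong[of _ _ sum_list] map_cong) (auto simp: facet)
  also have "\<dots> = 0"
    unfolding sphere_facets_def by simp
  finally show ?thesis .
qed

text \<open>
  The cocycle is the extension along the cell \<open>(4,1)\<close> of one that detects the link of that cell.
  Only the four triangles at \<open>(4,1)\<close> contribute to its value, and they contribute the value of the
  link.
\<close>
lemma nontrivial_board_1_mod_3:
  assumes n: "n = 4 + 3 * m"
  shows "\<not> trivial_group (reduced_homology_group (int (2 * m) + 2) (rook_complex (off_diagonal_board n)))"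
proof -
  let ?R = "block_pairs 4 m" and ?D = "rook_complex (off_diagonal_board n)"
  let ?P = "((1, 2), (1, 3)) # ((2, 4), (3, 4)) # ?R"
  let ?ts = "(1, n + 2, n + 3) # (n + 4, 2, 3) # block_triples n 4 m"
  have R: "map (map_prod (cell_edge n) (cell_edge n)) ?R = map fork (block_triples n 4 m)"
    "distinct (triple_vertices (block_triples n 4 m))" "pair_cells ?R \<subseteq> off_diagonal_board n"
    using n block_pairs_fork[of 4 m n] distinct_block_triples[of 4 m n] block_pairs_board[of 4 m n] by simp_all
  have P: "map (map_prod (cell_edge n) (cell_edge n)) ?P = map fork ?ts"
    using n R(1) by (simp add: edge_def)
  have ts: "distinct ((n + 1) # triple_vertices ?ts)"
    using n R(2) by (simp add: set_block_triples)
  have len: "length ?ts = 2 * m + 2" by (simp add: length_block_triples)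
  obtain f :: "(nat \<times> nat) set \<Rightarrow> 3" where f: "join_eval ?P f \<noteq> 0"
    "\<And>\<sigma>. cell_edge n ` \<sigma> \<in> matchings (insert (n + 1) (set (triple_vertices ?ts))) \<Longrightarrow>
      card \<sigma> = Suc (length ?ts) \<Longrightarrow> coboundary f \<sigma> = 0"
    using detecting_cocycle[OF P ts] by blast
  have verts: "{1..2 * n} - {4} \<subseteq> insert (n + 1) (set (triple_vertices ?ts))"
  proof
    fix v assume "v \<in> {1..2 * n} - {4}"
    then show "v \<in> insert (n + 1) (set (triple_vertices ?ts))"
      unfolding triple_vertices_simps list.set set_block_triples n by simp presburger
  qed
  have far: "4 < fst q \<and> 4 < snd q" if "\<sigma> \<in> choices ?R" "q \<in> \<sigma>" for \<sigma> q
    using block_pairs_cells choices_subset_cells[OF that(1)] that(2) by blast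
  have sep: "separated ?R" using separated_fork[OF R(2)] separated_image unfolding R(1)[symmetric] by blast
  show ?thesis
  proof (rule nontrivial_reduced_homology_group[OF simplicial_complex_rook_complex])
    show "pairing (coboundary h) (sphere_join ?R) = 0" for h :: "(nat \<times> nat) set \<Rightarrow> int"
      using sphere_join_cycle[OF sep] far by blast
    show "Poly_Mapping.keys (sphere_join ?R) \<subseteq> faces (int (2 * m) + 2) ?D"
    proof
      fix \<sigma> assume "\<sigma> \<in> Poly_Mapping.keys (sphere_join ?R)"
      then obtain s c d e \<rho> where fac: "(s, c, d, e) \<in> set sphere_facets" and \<rho>: "\<rho> \<in> choices ?R"
        and \<sigma>: "\<sigma> = insert c (insert d (insert e \<rho>))" by (rule keys_sphere_join)
      note cells = sphere_facets_cells[OF fac] and rooks = sphere_facets_rooks[OF fac]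
      have \<rho>': "\<rho> \<in> ?D" "card \<rho> = 2 * m"
        using choices_rook_complex[OF R \<rho>] by (simp_all add: length_block_triples)
      have board: "x \<in> off_diagonal_board n" if "x \<in> {c, d, e}" for x
        using cells[OF that] n by (auto simp: off_diagonal_board_iff)
      have away: "fst q \<noteq> fst x \<and> snd q \<noteq> snd x" if "x \<in> {c, d, e}" "q \<in> \<rho>" for x q
        using cells[OF that(1)] far[OF \<rho> that(2)] by auto
      have 1: "insert e \<rho> \<in> ?D \<and> card (insert e \<rho>) = Suc (card \<rho>)"
        by (rule rook_complex_insert[OF \<rho>'(1) board away]) simp_all
      have 2: "insert d (insert e \<rho>) \<in> ?D \<and> card (insert d (insert e \<rho>)) = Suc (card (insert e \<rho>))"
      proof (rule rook_complex_insert[OF conjunct1[OF 1] board])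
        show "fst q \<noteq> fst d \<and> snd q \<noteq> snd d" if "q \<in> insert e \<rho>" for q
          using that away[of d q] rooks by (elim insertE) auto
      qed simp
      have 3: "\<sigma> \<in> ?D \<and> card \<sigma> = Suc (card (insert d (insert e \<rho>)))"
        unfolding \<sigma>
      proof (rule rook_complex_insert[OF conjunct1[OF 2] board])
        show "fst q \<noteq> fst c \<and> snd q \<noteq> snd c" if "q \<in> insert d (insert e \<rho>)" for q
          using that away[of c q] rooks by (elim insertE) auto
      qed simp
      show "\<sigma> \<in> faces (int (2 * m) + 2) ?D"
        using 1 2 3 \<rho>'(2) unfolding faces_def by (simp add: rook_complex_def)
    qed
  next
    fix \<sigma> assume "\<sigma> \<in> faces (int (2 * m) + 2 + 1) ?D"
    then have \<sigma>: "\<sigma> \<in> ?D" "card \<sigma> = 2 * m + 4" "finite \<sigma>" by (auto simp: faces_def)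
    show "coboundary (extension (4, 1) f) \<sigma> = 0"
    proof (rule coboundary_extension[OF \<sigma>(3)])
      assume mem: "(4, 1) \<in> \<sigma>"
      have m: "cell_edge n ` \<sigma> \<in> matchings {1..2 * n}" by (rule rook_complex_matching[OF \<sigma>(1)])
      have "cell_edge n ` (\<sigma> - {(4, 1)}) \<in> matchings ({1..2 * n} - {4})"
      proof -
        have no4: "4 \<notin> {fst e, snd e}" if e: "e \<in> cell_edge n ` (\<sigma> - {(4, 1)})" for e
        proof -
          obtain q where q: "q \<in> \<sigma>" "q \<noteq> (4, 1)" "e = cell_edge n q" using e by blast
          have "fst q \<noteq> 4" using \<sigma>(1) q(1,2) mem unfolding rook_complex_def by fastforce
          then show ?thesis
            using q(1,3) \<sigma>(1) n unfolding rook_complex_def off_diagonal_board_def by (cases q) auto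
        qed
        have sub: "cell_edge n ` (\<sigma> - {(4, 1)}) \<in> matchings {1..2 * n}"
          by (rule matchings_subset[OF m]) blast
        show ?thesis
          by (rule matchings_avoid[OF sub]) (use no4 in auto)
      qed
      then show "coboundary f (\<sigma> - {(4, 1)}) = 0"
        using matchings_mono[OF _ verts] mem \<sigma>(2,3) by (intro f(2)) (auto simp: length_block_triples)
    qed
  next
    have not41: "(4, 1) \<notin> \<tau>" if "\<tau> \<in> choices ?P" for \<tau>
      using that far by fastforce
    have zero: "join_eval ?R (contraction e (contraction d (contraction c (extension (4, 1) f)))) = 0"
      if "(4, 1) \<notin> {c, d, e}" for c d e
    proof -
      have "join_eval ?R (contraction e (contraction d (contraction c (extension (4, 1) f)))) = join_eval ?R (\<lambda>_. 0 * 0)"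
      proof (rule join_eval_cong)
        fix \<sigma> assume "\<sigma> \<in> choices ?R"
        then have "(4, 1) \<notin> \<sigma>" using far by fastforce
        then show "contraction e (contraction d (contraction c (extension (4, 1) f))) \<sigma> = 0 * 0"
          using that by (simp add: contraction_def extension_def)
      qed
      then show ?thesis unfolding join_eval_scale by simp
    qed
    have "pairing (extension (4, 1) f) (sphere_join ?R) = join_eval ?P (contraction (4, 1) (extension (4, 1) f))"
      unfolding pairing_sphere_join sphere_facets_def by (simp add: zero del: One_nat_def)
    also have "\<dots> = join_eval ?P f"
      using not41 by (intro join_eval_cong contraction_extension) auto
    finally show "pairing (extension (4, 1) f) (sphere_join ?R) \<noteq> 0" using f(1) by simp
  qed
qed

theorem theorem8p3:
  fixes n :: nat
  assumes "n \<ge> 3"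
  shows "\<not> trivial_group (reduced_homology_group (nu (2 * n)) (rook_complex (off_diagonal_board n)))"
proof -
  have "(\<exists>k. n = 3 * k) \<or> (\<exists>m. n = 4 + 3 * m) \<or> (\<exists>m. n = 5 + 3 * m)"
    using assms by presburger
  then consider k where "n = 3 * k" | m where "n = 4 + 3 * m" | m where "n = 5 + 3 * m" by blast
  then show ?thesis
  proof cases
    case (1 k)
    have "nu (2 * n) = int (2 * k) - 1" unfolding nu_eq_div 1 by simp
    then show ?thesis using nontrivial_board_0_mod_3[OF 1] by simp
  next
    case (2 m)
    have "nu (2 * n) = int (2 * m) + 2" unfolding nu_eq_div 2 by simp
    then show ?thesis using nontrivial_board_1_mod_3[OF 2] by simp
  next
    case (3 m)
    have "nu (2 * n) = int (2 * m) + 2" unfolding nu_eq_div 3 by simp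
    then show ?thesis using nontrivial_board_2_mod_3[OF 3] by simp
  qed
qed

end
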